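(* Let $X_1,X_2$ be real random variables, let $\alpha\in[0,1]$, and let $U$ be a random variable independent of $X_1,X_2$ with values in $\{1,2\}$ and $\mathbb{P}[U=1]=\alpha$. Let $$X=\mathbf{1}_{\{U=1\}}X_1+\mathbf{1}_{\{U=2\}}X_2,$$ and let $Z$ be a real random variable independent of $(U,X_1,X_2)$. Suppose that $X_1$ is discrete, that $X_2$ has an absolutely continuous distribution (with respect to Lebesgue measure), and that $Z$ is a Doob's random variable. For $\sigma>0$ put $Y=X+\sigma Z$, $Y_2=X_2+\sigma Z$, and $$\mathcal{E}_\sigma=\frac{X-\mathbb{E}[X\mid Y]}{\sigma}=-Z+\mathbb{E}[Z\mid Y],\qquad \mathcal{E}_{2,\sigma}=\frac{X_2-\mathbb{E}[X_2\mid Y_2]}{\sigma}=-Z+\mathbb{E}[Z\mid Y_2].$$ Then, for every $\alpha\in[0,1]$, $$\lim_{\sigma\to0}\mathcal{E}_\sigma=\lim_{\sigma\to0}\mathbf{1}_{\{U=2\}}\mathcal{E}_{2,\sigma}=\mathbf{1}_{\{U=2\}}\left(\mathbb{E}[Z]-Z\right)\qquad\text{a.s.}$$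
   Context: Conditional expectations are given by the versions $$\mathbb{E}[Z\mid Y=y]=\frac{\mathbb{E}\left[\frac{y-X}{\sigma}f_Z\left(\frac{y-X}{\sigma}\right)\right]}{\mathbb{E}\left[f_Z\left(\frac{y-X}{\sigma}\right)\right]}$$ and likewise for $Y_2$ with $X$ replaced by $X_2$. Doob's random variable: a real random variable $Z$ whose density $f_Z$ satisfies the following conditions (those of Theorem 4.1 in Doob's 1960 paper on relative limit theorems, in the form below). There are strictly positive functions $\delta,\delta_1$ on $(0,\infty)$ with limit $0$ at $0$ such that: (A1) $f_Z(z)$ and $|z|f_Z(z)$ are bounded. (A2) $\liminf_{\sigma\to0}\inf_{|t|\le\delta(\sigma)}f_Z\left(z-\frac{t}{\sigma}\right)>0$ for all $z\in\mathbb{R}$. (A3) For any $\gamma>0$, $K(\sigma,\gamma):=\sup_{|t|\ge\gamma}\left|z-\frac{t}{\sigma}\right|f_Z\left(z-\frac{t}{\sigma}\right)=o(\delta(\sigma))$ as $\sigma\to0$, for all $z\in\mathbb{R}$; for any $\gamma_1>0$, $K_1(\sigma,\gamma_1):=\sup_{|t|\ge\gamma_1}f_Z\left(z-\frac{t}{\sigma}\right)=o(\delta_1(\sigma))$ as $\sigma\to0$, for all $z\in\mathbb{R}$. (A4) There is a constant $b$ such that $K(\sigma,|t|)\le b\left|z-\frac t\sigma\right|f_Z\left(z-\frac t\sigma\right)$ for $|t|\in[\delta(\sigma),\gamma]$, if $\gamma$ is sufficiently small, for all $z\in\mathbb{R}$; there is a constant $b_1$ such that $K_1(\sigma,|t|)\le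 b_1f_Z\left(z-\frac t\sigma\right)$ for $|t|\in[\delta_1(\sigma),\gamma_1]$, if $\gamma_1$ is sufficiently small, for all $z\in\mathbb{R}$. (A5) If $\gamma>0$, there is a number $\sigma_0$, which can be taken arbitrarily near $0$, for which $\left|z-\frac t\sigma\right|f_Z\left(z-\frac t\sigma\right)\le o(\delta(\sigma))\left|z-\frac t{\sigma_0}\right|f_Z\left(z-\frac t{\sigma_0}\right)$ for $|t|\ge\gamma$ and for all $z\in\mathbb{R}$, where $o(\delta(\sigma))$ may depend on $\gamma$ but not on $t$; if $\gamma_1>0$, there is a number $\sigma_{0,1}$, which can be taken arbitrarily near $0$, for which $f_Z\left(z-\frac t\sigma\right)\le o(\delta_1(\sigma))f_Z\left(z-\frac t{\sigma_{0,1}}\right)$ for $|t|\ge\gamma_1$ and for all $z\in\mathbb{R}$, where $o(\delta_1(\sigma))$ may depend on $\gamma_1$ but not on $t$. *)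

theory Defs
  imports "HOL-Probability.Probability" "HOL-Library.Landau_Symbols"
begin

text \<open>
  Independence of random variables with possibly different value types, through the generated
  \<open>\<sigma>\<close>-algebras (\<open>indep_var\<close> needs both variables to have values in the same type).
\<close>

definition indep_rv ::
  "'a measure \<Rightarrow> 'b measure \<Rightarrow> ('a \<Rightarrow> 'b) \<Rightarrow> 'c measure \<Rightarrow> ('a \<Rightarrow> 'c) \<Rightarrow> bool" where
  "indep_rv M S V T W \<longleftrightarrow>
     prob_space.indep_set M (sets (vimage_algebra (space M) V S)) (sets (vimage_algebra (space M) W T))"

definition tail_sup :: "(real \<Rightarrow> real) \<Rightarrow> real \<Rightarrow> real \<Rightarrow> real \<Rightarrow> real" where
  "tail_sup h z \<sigma> \<gamma> = (SUP t\<in>{t. \<gamma> \<le> \<bar>t\<bar>}. h (z - t / \<sigma>))"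

text \<open>
  The tail requirements on a kernel \<open>h\<close> at the point \<open>z\<close>; they are used both for
  \<open>h u = \<bar>u\<bar> * f u\<close> with rate \<open>\<delta>\<close> and for \<open>h = f\<close> with rate \<open>\<delta>\<^sub>1\<close>.  All three are
  statements about \<open>\<sigma> \<rightarrow> 0\<close>, so the pointwise inequalities are required for all
  sufficiently small \<open>\<sigma> > 0\<close>.  The function \<open>\<epsilon>\<close> in the last clause is the \<open>o(\<delta>(\<sigma>))\<close>
  factor, uniform in \<open>t\<close>.
\<close>

definition doob_tail :: "(real \<Rightarrow> real) \<Rightarrow> (real \<Rightarrow> real) \<Rightarrow> real \<Rightarrow> bool" where
  "doob_tail h \<delta> z \<longleftrightarrow>
     (\<forall>\<gamma>>0. (\<lambda>\<sigma>. tail_sup h z \<sigma> \<gamma>) \<in> o[at_right 0](\<delta>)) \<and>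
     (\<exists>b. \<forall>\<^sub>F \<gamma> in at_right 0. \<forall>\<^sub>F \<sigma> in at_right 0.
        \<forall>t. \<bar>t\<bar> \<in> {\<delta> \<sigma>..\<gamma>} \<longrightarrow> tail_sup h z \<sigma> \<bar>t\<bar> \<le> b * h (z - t / \<sigma>)) \<and>
     (\<forall>\<gamma>>0. \<exists>\<^sub>F \<sigma>\<^sub>0 in at_right 0. \<exists>\<epsilon>. \<epsilon> \<in> o[at_right 0](\<delta>) \<and>
        (\<forall>\<^sub>F \<sigma> in at_right 0. \<forall>t. \<gamma> \<le> \<bar>t\<bar> \<longrightarrow> h (z - t / \<sigma>) \<le> \<epsilon> \<sigma> * h (z - t / \<sigma>\<^sub>0)))"

definition doob_rate :: "(real \<Rightarrow> real) \<Rightarrow> bool" where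
  "doob_rate \<delta> \<longleftrightarrow> (\<forall>\<sigma>>0. 0 < \<delta> \<sigma>) \<and> (\<delta> \<longlongrightarrow> 0) (at_right 0)"

text \<open>
  ``For all \<open>z\<close>'' is the outermost quantifier: the conditions are imposed on the kernel
  \<open>t \<mapsto> f (z - t / \<sigma>)\<close> separately for each \<open>z\<close>, and the rates, the constants and
  \<open>\<sigma>\<^sub>0\<close> may depend on \<open>z\<close>.  Rates (or a \<open>\<sigma>\<^sub>0\<close>) common to all \<open>z\<close> would make the
  definition unsatisfiable: since \<open>f\<close> vanishes at infinity, the lower
  bound below forces \<open>\<delta> \<sigma> = O(\<sigma>)\<close>, whereas at
  \<open>t = \<sigma> * z\<close> the kernel \<open>\<bar>z - t / \<sigma>\<bar> * f (z - t / \<sigma>)\<close> vanishes, so that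
  \<open>\<sigma> * \<bar>z\<bar> < \<delta> \<sigma>\<close> is needed for small \<open>\<sigma>\<close>.
\<close>

definition doob_density :: "(real \<Rightarrow> real) \<Rightarrow> bool" where
  "doob_density f \<longleftrightarrow>
     (\<forall>u. 0 \<le> f u) \<and> bounded (range f) \<and> bounded (range (\<lambda>u. \<bar>u\<bar> * f u)) \<and>
     (\<forall>z. \<exists>\<delta> \<delta>\<^sub>1. doob_rate \<delta> \<and> doob_rate \<delta>\<^sub>1 \<and>
        0 < Liminf (at_right 0) (\<lambda>\<sigma>. INF t\<in>{t. \<bar>t\<bar> \<le> \<delta> \<sigma>}. ereal (f (z - t / \<sigma>))) \<and>
        doob_tail (\<lambda>u. \<bar>u\<bar> * f u) \<delta> z \<and> doob_tail f \<delta>\<^sub>1 z)"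

definition doob_random_variable :: "'a measure \<Rightarrow> ('a \<Rightarrow> real) \<Rightarrow> (real \<Rightarrow> real) \<Rightarrow> bool" where
  "doob_random_variable M Z f \<longleftrightarrow> distributed M lborel Z f \<and> doob_density f"

text \<open>
  For \<open>Y = X + \<sigma> Z\<close> with \<open>Z\<close> independent of \<open>X\<close> and of density \<open>f\<close>, \<open>cond_noise\<close> is the
  version of \<open>E[Z | Y = y]\<close> and \<open>cond_signal\<close> the corresponding version
  \<open>y - \<sigma> E[Z | Y = y]\<close> of \<open>E[X | Y = y]\<close>.
\<close>

definition cond_noise ::
  "'a measure \<Rightarrow> ('a \<Rightarrow> real) \<Rightarrow> (real \<Rightarrow> real) \<Rightarrow> real \<Rightarrow> real \<Rightarrow> real" where
  "cond_noise M X f \<sigma> y =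
     (\<integral>\<omega>. (y - X \<omega>) / \<sigma> * f ((y - X \<omega>) / \<sigma>) \<partial>M) / (\<integral>\<omega>. f ((y - X \<omega>) / \<sigma>) \<partial>M)"

definition cond_signal ::
  "'a measure \<Rightarrow> ('a \<Rightarrow> real) \<Rightarrow> (real \<Rightarrow> real) \<Rightarrow> real \<Rightarrow> real \<Rightarrow> real" where
  "cond_signal M X f \<sigma> y = y - \<sigma> * cond_noise M X f \<sigma> y"

definition scaled_error ::
  "'a measure \<Rightarrow> ('a \<Rightarrow> real) \<Rightarrow> ('a \<Rightarrow> real) \<Rightarrow> (real \<Rightarrow> real) \<Rightarrow> real \<Rightarrow> 'a \<Rightarrow> real" where
  "scaled_error M X Z f \<sigma> \<omega> = (X \<omega> - cond_signal M X f \<sigma> (X \<omega> + \<sigma> * Z \<omega>)) / \<sigma>"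

lemma scaled_error_eq:
  assumes "\<sigma> \<noteq> 0"
  shows "scaled_error M X Z f \<sigma> \<omega> = - Z \<omega> + cond_noise M X f \<sigma> (X \<omega> + \<sigma> * Z \<omega>)"
  using assms by (simp add: scaled_error_def cond_signal_def field_simps)

lemma real_cond_exp_eq_cond_noise:
  assumes M: "prob_space M"
    and indep: "prob_space.indep_var M borel X borel Z"
    and dens: "distributed M lborel Z f" and f0: "\<And>u. 0 \<le> f u"
    and bdd: "bounded (range f)" "bounded (range (\<lambda>u. \<bar>u\<bar> * f u))"
    and int: "integrable M Z" and \<sigma>: "0 < \<sigma>"
  shows "AE \<omega> in M.
    real_cond_exp M (vimage_algebra (space M) (\<lambda>\<omega>. X \<omega> + \<sigma> * Z \<omega>) borel) Z \<omega> =
    cond_noise M X f \<sigma> (X \<omega> + \<sigma> * Z \<omega>)"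
proof -
  interpret prob_space M by (rule M)
  have [measurable]: "X \<in> borel_measurable M" "Z \<in> borel_measurable M"
    using indep_var_rv1[OF indep] indep_var_rv2[OF indep] by auto
  have "(\<lambda>u. ennreal (f u)) \<in> borel_measurable borel"
    using dens by (auto simp: distributed_def)
  then have "(\<lambda>u. enn2real (ennreal (f u))) \<in> borel_measurable borel" by measurable
  then have [measurable]: "f \<in> borel_measurable borel" using f0 by simp
  define P where "P = distr M borel X"
  interpret P: prob_space P unfolding P_def by (rule prob_space_distr) simp
  have sP[measurable_cong, simp]: "sets P = sets borel" by (simp add: P_def)
  interpret PL: pair_sigma_finite P lborel ..
  define Y where "Y = (\<lambda>\<omega>. X \<omega> + \<sigma> * Z \<omega>)"
  have [measurable]: "Y \<in> borel_measurable M" unfolding Y_def by measurable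
  define d where "d = (\<lambda>(x,y). f ((y - x) / \<sigma>) / \<sigma>)"
  have d0: "0 \<le> d p" for p using f0 \<sigma> by (auto simp: d_def split: prod.split)
  have [measurable]: "d \<in> borel_measurable (P \<Otimes>\<^sub>M lborel)" unfolding d_def by measurable
  have XY: "distr M (borel \<Otimes>\<^sub>M borel) (\<lambda>\<omega>. (X \<omega>, Y \<omega>)) = density (P \<Otimes>\<^sub>M lborel) d"
  proof (rule measure_eqI)
    fix A assume "A \<in> sets (distr M (borel \<Otimes>\<^sub>M borel) (\<lambda>\<omega>. (X \<omega>, Y \<omega>)))"
    then have A[measurable]: "A \<in> sets (borel \<Otimes>\<^sub>M borel)" by simp
    interpret D: prob_space "density lborel (\<lambda>u. ennreal (f u))"
      using dens prob_space_distr[of Z lborel] by (auto simp: distributed_def)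
    have "emeasure (distr M (borel \<Otimes>\<^sub>M borel) (\<lambda>\<omega>. (X \<omega>, Y \<omega>))) A =
       (\<integral>\<^sup>+\<omega>. indicator A (X \<omega>, Y \<omega>) \<partial>M)"
      by (subst nn_integral_indicator[symmetric], simp, subst nn_integral_distr, auto)
    also have "\<dots> = (\<integral>\<^sup>+p. indicator A (fst p, fst p + \<sigma> * snd p)
        \<partial>distr M (borel \<Otimes>\<^sub>M borel) (\<lambda>\<omega>. (X \<omega>, Z \<omega>)))"
      by (subst nn_integral_distr) (auto simp: Y_def)
    also have "distr M (borel \<Otimes>\<^sub>M borel) (\<lambda>\<omega>. (X \<omega>, Z \<omega>)) = P \<Otimes>\<^sub>M distr M borel Z"
      using indep by (simp add: indep_var_distribution_eq P_def)
    also have "distr M borel Z = density lborel (\<lambda>u. ennreal (f u))"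
      using dens by (simp add: distributed_def cong: distr_cong)
    also have "(\<integral>\<^sup>+p. indicator A (fst p, fst p + \<sigma> * snd p) \<partial>(P \<Otimes>\<^sub>M density lborel (\<lambda>u. ennreal (f u)))) =
       (\<integral>\<^sup>+x. \<integral>\<^sup>+z. indicator A (x, x + \<sigma> * z) \<partial>density lborel (\<lambda>u. ennreal (f u)) \<partial>P)"
      by (subst D.nn_integral_fst[symmetric]) auto
    also have "\<dots> = (\<integral>\<^sup>+x. \<integral>\<^sup>+z. ennreal (f z) * indicator A (x, x + \<sigma> * z) \<partial>lborel \<partial>P)"
      by (intro nn_integral_cong, subst nn_integral_density) auto
    also have "\<dots> = (\<integral>\<^sup>+x. \<integral>\<^sup>+y. ennreal (d (x, y)) * indicator A (x, y) \<partial>lborel \<partial>P)"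
    proof (rule nn_integral_cong)
      fix x
      have "(\<integral>\<^sup>+y. ennreal (d (x, y)) * indicator A (x, y) \<partial>lborel) =
        \<bar>\<sigma>\<bar> * (\<integral>\<^sup>+z. ennreal (d (x, x + \<sigma> * z)) * indicator A (x, x + \<sigma> * z) \<partial>lborel)"
        using \<sigma> by (intro nn_integral_real_affine) (auto simp: d_def)
      also have "\<dots> = (\<integral>\<^sup>+z. \<bar>\<sigma>\<bar> * (ennreal (d (x, x + \<sigma> * z)) * indicator A (x, x + \<sigma> * z)) \<partial>lborel)"
        by (subst nn_integral_cmult) (auto simp: d_def)
      also have "\<dots> = (\<integral>\<^sup>+z. ennreal (f z) * indicator A (x, x + \<sigma> * z) \<partial>lborel)"
        using \<sigma> f0 by (intro nn_integral_cong)
          (auto simp: d_def ennreal_mult''[symmetric] split: split_indicator)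
      finally show "(\<integral>\<^sup>+z. ennreal (f z) * indicator A (x, x + \<sigma> * z) \<partial>lborel) =
         (\<integral>\<^sup>+y. ennreal (d (x, y)) * indicator A (x, y) \<partial>lborel)" by simp
    qed
    also have "\<dots> = (\<integral>\<^sup>+p. ennreal (d p) * indicator A p \<partial>(P \<Otimes>\<^sub>M lborel))"
      by (subst lborel.nn_integral_fst[symmetric]) auto
    also have "\<dots> = emeasure (density (P \<Otimes>\<^sub>M lborel) d) A"
      by (subst emeasure_density) auto
    finally show "emeasure (distr M (borel \<Otimes>\<^sub>M borel) (\<lambda>\<omega>. (X \<omega>, Y \<omega>))) A =
      emeasure (density (P \<Otimes>\<^sub>M lborel) d) A" .
  qed (simp cong: sets_pair_measure_cong)
  have transfer_int: "integrable M (\<lambda>\<omega>. h (X \<omega>, Y \<omega>)) \<longleftrightarrow> integrable (P \<Otimes>\<^sub>M lborel) (\<lambda>p. d p * h p)"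
    if [measurable]: "h \<in> borel_measurable (borel \<Otimes>\<^sub>M borel)" for h :: "real \<times> real \<Rightarrow> real"
  proof -
    have "integrable M (\<lambda>\<omega>. h (X \<omega>, Y \<omega>)) \<longleftrightarrow>
        integrable (distr M (borel \<Otimes>\<^sub>M borel) (\<lambda>\<omega>. (X \<omega>, Y \<omega>))) h"
      by (subst integrable_distr_eq) auto
    also have "\<dots> \<longleftrightarrow> integrable (P \<Otimes>\<^sub>M lborel) (\<lambda>p. d p * h p)"
      unfolding XY using d0 by (subst integrable_density) auto
    finally show ?thesis .
  qed
  have transfer: "(\<integral>\<omega>. h (X \<omega>, Y \<omega>) \<partial>M) = (\<integral>p. d p * h p \<partial>(P \<Otimes>\<^sub>M lborel))"
    if [measurable]: "h \<in> borel_measurable (borel \<Otimes>\<^sub>M borel)" for h :: "real \<times> real \<Rightarrow> real"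
  proof -
    have "(\<integral>\<omega>. h (X \<omega>, Y \<omega>) \<partial>M) = (\<integral>p. h p \<partial>distr M (borel \<Otimes>\<^sub>M borel) (\<lambda>\<omega>. (X \<omega>, Y \<omega>)))"
      by (subst integral_distr) auto
    also have "\<dots> = (\<integral>p. d p * h p \<partial>(P \<Otimes>\<^sub>M lborel))"
      unfolding XY using d0 by (subst integral_density) auto
    finally show ?thesis .
  qed
  define num where "num = (\<lambda>y. \<integral>x. (y - x) / \<sigma> * f ((y - x) / \<sigma>) \<partial>P)"
  define den where "den = (\<lambda>y. \<integral>x. f ((y - x) / \<sigma>) \<partial>P)"
  define m where "m = (\<lambda>y. num y / den y)"
  have m: "cond_noise M X f \<sigma> y = m y" for y
    by (simp add: cond_noise_def m_def num_def den_def P_def integral_distr)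
  have [measurable]: "num \<in> borel_measurable borel" "den \<in> borel_measurable borel"
    unfolding num_def den_def by measurable
  then have [measurable]: "m \<in> borel_measurable borel" unfolding m_def by measurable
  obtain B where B: "\<And>u. \<bar>f u\<bar> \<le> B" using bdd(1) by (auto simp: bounded_iff)
  obtain C where C: "\<And>u. \<bar>\<bar>u\<bar> * f u\<bar> \<le> C" using bdd(2) by (auto simp: bounded_iff)
  have iden: "integrable P (\<lambda>x. f ((y - x) / \<sigma>))" for y
    using B by (intro P.integrable_const_bound[of _ B]) auto
  have inum: "integrable P (\<lambda>x. (y - x) / \<sigma> * f ((y - x) / \<sigma>))" for y
    using C[of "(y - x) / \<sigma>" for x] by (intro P.integrable_const_bound[of _ C]) (auto simp: abs_mult)
  have md: "m y * den y = num y" for y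
  proof (cases "den y = 0")
    case True
    then have "AE x in P. f ((y - x) / \<sigma>) = 0"
      unfolding den_def using iden f0 by (subst (asm) integral_nonneg_eq_0_iff_AE) auto
    then have "num y = 0" unfolding num_def by (intro integral_eq_zero_AE) auto
    then show ?thesis using True by simp
  qed (simp add: m_def)
  have Z: "Z \<omega> = (Y \<omega> - X \<omega>) / \<sigma>" for \<omega> using \<sigma> by (simp add: Y_def)
  define g where "g = (\<lambda>p::real\<times>real. (snd p - fst p) / \<sigma>)"
  have [measurable]: "g \<in> borel_measurable (borel \<Otimes>\<^sub>M borel)" unfolding g_def by measurable
  have ig: "integrable (P \<Otimes>\<^sub>M lborel) (\<lambda>p. d p * g p)"
    using int by (subst transfer_int[symmetric]) (auto simp: g_def Z[symmetric])
  have id: "integrable (P \<Otimes>\<^sub>M lborel) d"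
    using transfer_int[of "\<lambda>_. 1"] by simp
  have dg: "d (x, y) * g (x, y) = (y - x) / \<sigma> * f ((y - x) / \<sigma>) / \<sigma>" for x y
    by (simp add: d_def g_def)
  have dfst: "(\<integral>x. d (x, y) * g (x, y) \<partial>P) = num y / \<sigma>" for y
    unfolding dg num_def by (rule integral_divide_zero)
  have dden: "(\<integral>x. d (x, y) \<partial>P) = den y / \<sigma>" for y
    by (simp add: d_def den_def)
  have imd: "integrable (P \<Otimes>\<^sub>M lborel) (\<lambda>p. d p * m (snd p))"
  proof -
    have nn: "(\<integral>\<^sup>+p. ennreal (norm (d p * m (snd p))) \<partial>(P \<Otimes>\<^sub>M lborel)) =
       (\<integral>\<^sup>+y. \<integral>\<^sup>+x. ennreal (norm (d (x, y) * m y)) \<partial>P \<partial>lborel)"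
      by (subst PL.nn_integral_snd[symmetric]) auto
    also have "\<dots> \<le> (\<integral>\<^sup>+y. \<integral>\<^sup>+x. ennreal (norm (d (x, y) * g (x, y))) \<partial>P \<partial>lborel)"
    proof (rule nn_integral_mono)
      fix y
      have i1: "integrable P (\<lambda>x. d (x, y))" using iden[of y] by (simp add: d_def)
      have i2: "integrable P (\<lambda>x. d (x, y) * g (x, y))"
        unfolding dg using inum[of y] by (rule integrable_divide_zero)
      have "(\<integral>\<^sup>+x. ennreal (norm (d (x, y) * m y)) \<partial>P) = ennreal (\<integral>x. norm (d (x, y) * m y) \<partial>P)"
        using i1 by (intro nn_integral_eq_integral) auto
      also have "(\<integral>x. norm (d (x, y) * m y) \<partial>P) = (\<integral>x. d (x, y) \<partial>P) * \<bar>m y\<bar>"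
        using d0 by (simp add: abs_mult)
      also have "\<dots> = \<bar>\<integral>x. d (x, y) * g (x, y) \<partial>P\<bar>"
      proof -
        have "0 \<le> den y" unfolding den_def using f0 by (intro integral_nonneg_AE) auto
        then show ?thesis unfolding dden dfst md[symmetric] using \<sigma> by (simp add: abs_mult)
      qed
      also have "ennreal \<dots> \<le> ennreal (\<integral>x. norm (d (x, y) * g (x, y)) \<partial>P)"
        using integral_norm_bound[of P "\<lambda>x. d (x, y) * g (x, y)"] by (intro ennreal_leI) simp
      also have "\<dots> = (\<integral>\<^sup>+x. ennreal (norm (d (x, y) * g (x, y))) \<partial>P)"
        using i2 by (intro nn_integral_eq_integral[symmetric]) auto
      finally show "(\<integral>\<^sup>+x. ennreal (norm (d (x, y) * m y)) \<partial>P) \<le>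
         (\<integral>\<^sup>+x. ennreal (norm (d (x, y) * g (x, y))) \<partial>P)" .
    qed
    also have "\<dots> = (\<integral>\<^sup>+p. ennreal (norm (d p * g p)) \<partial>(P \<Otimes>\<^sub>M lborel))"
      by (subst PL.nn_integral_snd[symmetric]) auto
    also have "\<dots> < \<infinity>" using ig by (simp add: integrable_iff_bounded)
    finally show ?thesis by (intro integrableI_bounded) auto
  qed
  have imY: "integrable M (\<lambda>\<omega>. m (Y \<omega>))"
    using imd transfer_int[of "\<lambda>p. m (snd p)"] by simp
  define F where "F = vimage_algebra (space M) Y borel"
  have sub: "subalgebra M F"
    unfolding subalgebra_def F_def by (auto simp: sets_vimage_algebra2)
  interpret F: finite_measure_subalgebra M F by unfold_locales (rule sub)
  have YF[measurable]: "Y \<in> measurable F borel"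
    unfolding F_def by (rule measurable_vimage_algebra1) auto
  have "AE \<omega> in M. real_cond_exp M F Z \<omega> = m (Y \<omega>)"
  proof (rule F.real_cond_exp_charact)
    fix A assume "A \<in> sets F"
    then obtain B where [measurable]: "B \<in> sets borel" and A: "A = Y -` B \<inter> space M"
      by (auto simp: F_def sets_vimage_algebra2)
    have iB: "integrable (P \<Otimes>\<^sub>M lborel) (\<lambda>p. d p * (indicator B (snd p) * h p))"
      if [measurable]: "h \<in> borel_measurable (borel \<Otimes>\<^sub>M borel)" 
        and i: "integrable (P \<Otimes>\<^sub>M lborel) (\<lambda>p. d p * h p)" for h :: "real \<times> real \<Rightarrow> real"
      by (rule Bochner_Integration.integrable_bound[OF i]) (auto split: split_indicator)
    have "(\<integral>\<omega>\<in>A. Z \<omega> \<partial>M) = (\<integral>\<omega>. indicator B (Y \<omega>) * g (X \<omega>, Y \<omega>) \<partial>M)"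
      unfolding set_lebesgue_integral_def A
      by (intro Bochner_Integration.integral_cong) (auto simp: g_def Z[symmetric] split: split_indicator)
    also have "\<dots> = (\<integral>p. d p * (indicator B (snd p) * g p) \<partial>(P \<Otimes>\<^sub>M lborel))"
      using transfer[of "\<lambda>p. indicator B (snd p) * g p"] by simp
    also have "\<dots> = (\<integral>y. \<integral>x. d (x, y) * (indicator B y * g (x, y)) \<partial>P \<partial>lborel)"
      using PL.integral_snd[of "\<lambda>x y. d (x, y) * (indicator B y * g (x, y))"] iB[OF _ ig]
      by (simp add: case_prod_beta')
    also have "\<dots> = (\<integral>y. \<integral>x. d (x, y) * (indicator B y * m y) \<partial>P \<partial>lborel)"
    proof (rule Bochner_Integration.integral_cong[OF refl])
      fix y
      have "(\<integral>x. d (x, y) * (indicator B y * g (x, y)) \<partial>P) = indicator B y * (\<integral>x. d (x, y) * g (x, y) \<partial>P)"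
        by (subst integral_mult_right_zero[symmetric]) (simp add: ac_simps)
      also have "\<dots> = (indicator B y * m y) * (\<integral>x. d (x, y) \<partial>P)"
        unfolding dfst dden md[symmetric] by simp
      also have "\<dots> = (\<integral>x. d (x, y) * (indicator B y * m y) \<partial>P)"
        by simp
      finally show "(\<integral>x. d (x, y) * (indicator B y * g (x, y)) \<partial>P) = \<dots>" .
    qed
    also have "\<dots> = (\<integral>p. d p * (indicator B (snd p) * m (snd p)) \<partial>(P \<Otimes>\<^sub>M lborel))"
      using PL.integral_snd[of "\<lambda>x y. d (x, y) * (indicator B y * m y)"] iB[OF _ imd]
      by (simp add: case_prod_beta')
    also have "\<dots> = (\<integral>\<omega>. indicator B (Y \<omega>) * m (Y \<omega>) \<partial>M)"
      using transfer[of "\<lambda>p. indicator B (snd p) * m (snd p)"] by simp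
    also have "\<dots> = (\<integral>\<omega>\<in>A. m (Y \<omega>) \<partial>M)"
      unfolding set_lebesgue_integral_def A
      by (intro Bochner_Integration.integral_cong) (auto split: split_indicator)
    finally show "(\<integral>\<omega>\<in>A. Z \<omega> \<partial>M) = (\<integral>\<omega>\<in>A. m (Y \<omega>) \<partial>M)" .
  qed (use int imY in auto)
  then show ?thesis unfolding F_def m Y_def .
qed

end

theory Submission
  imports Defs
begin

text \<open>
  The density conditions imply that \<open>f (z - v)\<close> and \<open>\<bar>z - v\<bar> * f (z - v)\<close> are dominated by \<open>G \<bar>v\<bar>\<close>
  with \<open>G\<close> decreasing and integrable.  Hence the numerator and the denominator of \<open>E[Z | Y = x + \<sigma> z]\<close>,
  divided by \<open>\<sigma>\<close>, are approximate identities applied to the law of \<open>X\<close> at \<open>x\<close>.  The law of \<open>X\<close> is a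
  discrete measure plus a measure with a density \<open>g\<close>.  At an atom \<open>x\<close> its mass dominates both
  integrals and the quotient tends to \<open>z\<close>.  At almost every other \<open>x\<close> the discrete part has derivative
  \<open>0\<close>, \<open>x\<close> is a Lebesgue point of \<open>g\<close>, and the quotient tends to
  \<open>(g x * \<integral>u f(u) du) / (g x * \<integral>f(u) du) = E[Z]\<close>.  As \<open>g x > 0\<close> holds almost surely under the
  second part, this gives the limit on \<open>U = 2\<close>.  The exceptional set of
  \<open>x\<close> does not depend on \<open>z\<close>, so \<open>z = Z \<omega>\<close> may be inserted.
\<close>

section \<open>Derivatives of measures on the line\<close>

text \<open>Differentiation of measures controls only the mass of balls centred at \<open>x\<close>.
  Integrals of a radially decreasing kernel can be estimated from this alone, because its superlevel
  sets are centred intervals; hence the majorant \<open>G\<close>. The majorant exists for the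
  following reason. In the variable v = t / \<sigma>, boundedness of |u| * f u and (A2) force the
  rate \<delta> to be O(\<sigma>). Then (A5) makes a dilation by a suitable s > 1 shrink |u| * f u
  by a factor of at least 2 s far out, which gives integrability by absorbing half of the integral.
  (A4) keeps the supremum of |z - w| * f (z - w) over |w| >= |v| within a constant factor of its
  value at v for large |v|, so this supremum is integrable as well. At an atom the two integrals
  converge without division by \<sigma>, elsewhere after it; their quotient does not see the
  difference. The null sets arise from differentiating the law of X, before any kernel is
  chosen.\<close>

lemma AE_lborel_zero_density:
  fixes \<nu> :: "real measure"
  assumes fin: "finite_measure \<nu>" and sets[measurable_cong]: "sets \<nu> = sets borel"
    and A: "A \<in> sets borel" "emeasure \<nu> A = 0"
  shows "AE x in lborel. x \<in> A \<longrightarrow> ((\<lambda>r. measure \<nu> (cball x r) / r) \<longlongrightarrow> 0) (at_right 0)"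
proof -
  interpret finite_measure \<nu> by (rule fin)
  \<comment> \<open>The conclusion fails at a point of \<open>A\<close> exactly if the point lies in
    \<open>E a\<close> for some \<open>a > 0\<close>, and the values a = 1 / (n + 1)
    suffice.\<close>
  define E where "E a = {x \<in> A. \<exists>\<^sub>F r in at_right 0. a * r < measure \<nu> (cball x r)}" for a
  \<comment> \<open>Vitali's covering lemma inside an open set \<open>V \<supseteq> A\<close> of small \<open>\<nu>\<close>-measure.\<close>
  have negl: "negligible (E a)" if a: "0 < a" for a
    unfolding negligible_outer_le
  proof (intro allI impI)
    fix e :: real assume e: "0 < e"
    \<comment> \<open>The 10 is the length of an interval of radius 5, the enlargement factor of the
      covering lemma. On \<open>E a\<close> a radius is less than the \<nu>-mass of its ball divided
      by \<open>a\<close>, so disjoint balls inside \<open>V\<close> yield a cover of length at most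
      10 / a times the mass of \<open>V\<close>.\<close>
    have "(INF U\<in>{U. A \<subseteq> U \<and> open U}. emeasure \<nu> U) < ennreal (a * e / 10)"
      using outer_regular[of \<nu> A] sets A a e by (simp add: emeasure_eq_measure)
    then obtain V where V: "A \<subseteq> V" "open V" "emeasure \<nu> V < ennreal (a * e / 10)"
      by (auto simp: INF_less_iff)
    have mV: "measure \<nu> V < a * e / 10"
      using V(3) a e by (simp add: emeasure_eq_measure ennreal_less_iff)
    \<comment> \<open>The cap 1 supplies the uniform bound on radii that the covering lemma
      requires.\<close>
    have "\<exists>r. 0 < r \<and> r \<le> 1 \<and> cball x r \<subseteq> V \<and> a * r < measure \<nu> (cball x r)" if x: "x \<in> E a" for x
    proof -
      have "x \<in> V" using x V by (auto simp: E_def)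
      then obtain d where d: "0 < d" "cball x d \<subseteq> V" using V(2) open_contains_cball by blast
      have "\<forall>\<^sub>F r in at_right 0. 0 < r \<and> r \<le> min d 1"
        using d by (auto simp: eventually_at_right_field intro!: exI[of _ "min d 1"])
      moreover have "\<exists>\<^sub>F r in at_right 0. a * r < measure \<nu> (cball x r)"
        using x by (auto simp: E_def)
      ultimately have "\<exists>\<^sub>F r in at_right 0. (0 < r \<and> r \<le> min d 1) \<and> a * r < measure \<nu> (cball x r)"
        by (rule frequently_eventually_conj[rotated])
      then obtain r where r: "a * r < measure \<nu> (cball x r)" "0 < r" "r \<le> min d 1"
        by (auto dest: frequently_ex)
      moreover have "cball x r \<subseteq> cball x d" using r by (intro subset_cball) auto
      ultimately show ?thesis using d by (intro exI[of _ r]) auto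
    qed
    then obtain r where r: "\<And>x. x \<in> E a \<Longrightarrow> 0 < r x \<and> r x \<le> 1 \<and> cball x (r x) \<subseteq> V \<and>
        a * r x < measure \<nu> (cball x (r x))"
      by metis
    obtain C where C: "countable C" "C \<subseteq> E a"
        "pairwise (\<lambda>i j. disjnt (cball i (r i)) (cball j (r j))) C"
        "E a \<subseteq> (\<Union>i\<in>C. cball i (5 * r i))"
    proof (rule Vitali_covering_lemma_cballs[where S = "E a" and K = "E a" and a = "\<lambda>x. x" and r = r and B = 1])
      show "E a \<subseteq> (\<Union>i\<in>E a. cball i (r i))" using r by force
    qed (use r in auto)
    have bound: "measure lebesgue (\<Union>i\<in>D. cball i (5 * r i)) \<le> e"
      if D: "D \<subseteq> C" "finite D" for D
    proof -
      have rD: "0 < r i" "a * r i \<le> measure \<nu> (cball i (r i))" "cball i (r i) \<subseteq> V" if "i \<in> D" for i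
        using r[of i] that D C by auto
      have disj: "disjoint_family_on (\<lambda>i. cball i (r i)) D"
        using C(3) D by (auto simp: disjoint_family_on_def pairwise_def disjnt_def)
      have "measure lebesgue (\<Union>i\<in>D. cball i (5 * r i)) \<le> (\<Sum>i\<in>D. measure lebesgue (cball i (5 * r i)))"
        using D by (intro measure_UNION_le) auto
      also have "\<dots> = (\<Sum>i\<in>D. 10 / a * (a * r i))"
        using rD a by (intro sum.cong) (auto simp: cball_eq_atLeastAtMost less_imp_le)
      also have "\<dots> \<le> (\<Sum>i\<in>D. 10 / a * measure \<nu> (cball i (r i)))"
        using rD a by (intro sum_mono mult_left_mono) auto
      also have "\<dots> = 10 / a * measure \<nu> (\<Union>i\<in>D. cball i (r i))"
        using D disj by (subst finite_measure_finite_Union) (auto simp: sum_distrib_left sets)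
      also have "\<dots> \<le> 10 / a * measure \<nu> V"
        using rD V a by (intro mult_left_mono finite_measure_mono) (auto simp: sets)
      also have "\<dots> \<le> e" using mV a by (simp add: field_simps)
      finally show ?thesis .
    qed
    show "\<exists>T. E a \<subseteq> T \<and> T \<in> lmeasurable \<and> measure lebesgue T \<le> e"
    proof (intro exI conjI)
      show "E a \<subseteq> (\<Union>i\<in>C. cball i (5 * r i))" by (rule C)
      show "(\<Union>i\<in>C. cball i (5 * r i)) \<in> lmeasurable"
        using bound by (intro fmeasurable_UN_bound[OF C(1)]) auto
      show "measure lebesgue (\<Union>i\<in>C. cball i (5 * r i)) \<le> e"
        using bound by (intro measure_UN_bound[OF C(1)]) auto
    qed
  qed
  have "negligible (\<Union>n. E (1 / real (Suc n)))"
    by (intro negligible_countable_Union) (auto intro!: negl)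
  then have "AE x in lborel. x \<notin> (\<Union>n. E (1 / real (Suc n)))"
    unfolding negligible_iff_null_sets by (auto dest!: AE_not_in simp: AE_completion_iff)
  then show ?thesis
  proof eventually_elim
    case (elim x)
    show ?case
    proof (intro impI tendstoI)
      fix e :: real assume x: "x \<in> A" and "0 < e"
      then obtain n where n: "1 / real (Suc n) < e" using nat_approx_posE by blast
      have "\<forall>\<^sub>F r in at_right 0. \<not> 1 / real (Suc n) * r < measure \<nu> (cball x r)"
        using elim x by (auto simp: E_def not_frequently)
      moreover have "\<forall>\<^sub>F r in at_right 0. (0::real) < r" by (rule eventually_at_right_less)
      ultimately show "\<forall>\<^sub>F r in at_right 0. dist (measure \<nu> (cball x r) / r) 0 < e"
      proof eventually_elim
        case (elim r)
        have "1 / real (Suc n) * r < e * r" using elim n by (intro mult_strict_right_mono)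
        then have "measure \<nu> (cball x r) < e * r" using elim by linarith
        then show ?case using elim by (simp add: pos_divide_less_eq)
      qed
    qed
  qed
qed

section \<open>Integrable densities and their Lebesgue points\<close>

lemma finite_measure_density_integrable:
  fixes \<phi> :: "'a \<Rightarrow> real"
  assumes int: "integrable M \<phi>" and nn: "\<And>x. 0 \<le> \<phi> x"
  shows "finite_measure (density M (\<lambda>x. ennreal (\<phi> x)))"
proof (rule finite_measureI)
  have "emeasure (density M (\<lambda>x. ennreal (\<phi> x))) (space M) = ennreal (integral\<^sup>L M \<phi>)"
    using int nn by (simp add: emeasure_density nn_integral_eq_integral)
  then show "emeasure (density M (\<lambda>x. ennreal (\<phi> x))) (space (density M (\<lambda>x. ennreal (\<phi> x)))) \<noteq> \<infinity>"
    by simp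
qed

lemma measure_density_integrable:
  fixes \<phi> :: "'a \<Rightarrow> real"
  assumes int: "integrable M \<phi>" and nn: "\<And>x. 0 \<le> \<phi> x" and A: "A \<in> sets M"
  shows "measure (density M (\<lambda>x. ennreal (\<phi> x))) A = (\<integral>x\<in>A. \<phi> x \<partial>M)"
proof -
  have [measurable]: "\<phi> \<in> borel_measurable M" using int by auto
  have i: "integrable M (\<lambda>x. indicator A x * \<phi> x)"
    using int A by (intro integrable_mult_indicator[where 'b=real, simplified]) auto
  have "emeasure (density M (\<lambda>x. ennreal (\<phi> x))) A = (\<integral>\<^sup>+x. ennreal (indicator A x * \<phi> x) \<partial>M)"
    using A by (subst emeasure_density) (auto intro!: nn_integral_cong split: split_indicator)
  also have "\<dots> = ennreal (\<integral>x\<in>A. \<phi> x \<partial>M)"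
    using i nn by (subst nn_integral_eq_integral) (auto simp: set_lebesgue_integral_def)
  finally show ?thesis
    using nn by (auto simp: measure_def set_lebesgue_integral_def intro!: integral_nonneg_AE)
qed

text \<open>The measure with density \<phi> does not charge the set where \<phi> vanishes, so the
  preceding lemma applies to that set.\<close>

lemma AE_lborel_zero_density_integral:
  fixes \<phi> :: "real \<Rightarrow> real"
  assumes int: "integrable lborel \<phi>" and nn: "\<And>x. 0 \<le> \<phi> x"
  shows "AE x in lborel. \<phi> x = 0 \<longrightarrow> ((\<lambda>r. (\<integral>y\<in>cball x r. \<phi> y \<partial>lborel) / r) \<longlongrightarrow> 0) (at_right 0)"
proof -
  have [measurable]: "\<phi> \<in> borel_measurable borel" using int by auto
  have "AE x in lborel. x \<in> {x. \<phi> x = 0} \<longrightarrow>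
      ((\<lambda>r. measure (density lborel (\<lambda>y. ennreal (\<phi> y))) (cball x r) / r) \<longlongrightarrow> 0) (at_right 0)"
  proof (rule AE_lborel_zero_density[OF finite_measure_density_integrable[OF int nn]])
    show "emeasure (density lborel (\<lambda>y. ennreal (\<phi> y))) {x. \<phi> x = 0} = 0"
      by (subst emeasure_density) (auto simp: nn_integral_0_iff_AE intro!: AE_I2 split: split_indicator)
  qed auto
  then show ?thesis by (simp add: measure_density_integrable[OF int nn])
qed

text \<open>Rational thresholds approximate \<open>g x\<close> from both sides, so the
  zero-derivative lemma has to be applied only countably often and the exceptional null sets can be
  united.\<close>

lemma AE_lborel_Lebesgue_point:
  fixes g :: "real \<Rightarrow> real"
  assumes int: "integrable lborel g"
  shows "AE x in lborel. ((\<lambda>r. (\<integral>y\<in>cball x r. \<bar>g y - g x\<bar> \<partial>lborel) / r) \<longlongrightarrow> 0) (at_right 0)"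
proof -
  have [measurable]: "g \<in> borel_measurable borel" using int by auto
  \<comment> \<open>The truncation makes the constants \<open>q\<close> integrable. It is invisible
    near \<open>x\<close>, since \<open>I n\<close> contains the ball of radius 1 about
    \<open>x\<close> once n > |x| + 1.\<close>
  define I where "I n = {- real n<..<real n}" for n
  \<comment> \<open>The truncated measures \<open>(g - q)\<^sup>+\<close> and \<open>(q - g)\<^sup>+\<close>, for rational \<open>q\<close> on either side of \<open>g x\<close>,
     have derivative \<open>0\<close> at \<open>x\<close> because they vanish on \<open>{g \<le> q}\<close> and \<open>{g \<ge> q}\<close>.\<close>
  define \<phi> where "\<phi> n q y = indicator (I n) y * max 0 (g y - real_of_rat q)" for n q y
  define \<psi> where "\<psi> n q y = indicator (I n) y * max 0 (real_of_rat q - g y)" for n q y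
  have [measurable]: "I n \<in> sets borel" for n by (simp add: I_def)
  have [measurable]: "\<phi> n q \<in> borel_measurable borel" "\<psi> n q \<in> borel_measurable borel" for n q
    unfolding \<phi>_def \<psi>_def by measurable
  have Ic: "integrable lborel (\<lambda>y. indicator (I n) y * c)" for n and c :: real
    by (intro integrable_mult_left) (auto simp: I_def)
  have I: "set_integrable lborel (I n) (\<lambda>y. g y - c)" "set_integrable lborel (I n) (\<lambda>y. c - g y)" for n c
    using int by (auto simp: set_integrable_def right_diff_distrib I_def[of n]
        intro!: Bochner_Integration.integrable_diff Ic[unfolded I_def] integrable_mult_indicator[where 'b=real, simplified])
  have i\<phi>: "integrable lborel (\<phi> n q)" for n q
    by (rule Bochner_Integration.integrable_bound[OF I(1)[of n "of_rat q", unfolded set_integrable_def]])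
      (auto simp: \<phi>_def I_def split: split_indicator)
  have i\<psi>: "integrable lborel (\<psi> n q)" for n q
    by (rule Bochner_Integration.integrable_bound[OF I(2)[of n "of_rat q", unfolded set_integrable_def]])
      (auto simp: \<psi>_def I_def split: split_indicator)
  have "AE x in lborel. \<forall>n q.
      (\<phi> n q x = 0 \<longrightarrow> ((\<lambda>r. (\<integral>y\<in>cball x r. \<phi> n q y \<partial>lborel) / r) \<longlongrightarrow> 0) (at_right 0)) \<and>
      (\<psi> n q x = 0 \<longrightarrow> ((\<lambda>r. (\<integral>y\<in>cball x r. \<psi> n q y \<partial>lborel) / r) \<longlongrightarrow> 0) (at_right 0))"
    unfolding AE_all_countable AE_conj_iff
    by (intro allI conjI AE_lborel_zero_density_integral i\<phi> i\<psi>) (auto simp: \<phi>_def \<psi>_def)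
  then show ?thesis
  proof eventually_elim
    case (elim x)
    show ?case
    proof (rule tendstoI)
      fix e :: real assume e: "0 < e"
      obtain n where n: "\<bar>x\<bar> + 1 < real n" using reals_Archimedean2 by blast
      \<comment> \<open>On the ball, |g y - g x| is at most the sum of the two truncated functions
        plus e / 4. The constant integrates to r * e / 2 over length 2 r, and each function
        contributes less than r * e / 8, which leaves a total below r * e.\<close>
      obtain q where q: "g x < of_rat q" "of_rat q < g x + e / 8"
        using of_rat_dense[of "g x" "g x + e / 8"] e by auto
      obtain p where p: "g x - e / 8 < of_rat p" "of_rat p < g x"
        using of_rat_dense[of "g x - e / 8" "g x"] e by auto
      have "\<phi> n q x = 0" "\<psi> n p x = 0" using p q by (auto simp: \<phi>_def \<psi>_def)
      then have lim: "((\<lambda>r. (\<integral>y\<in>cball x r. \<phi> n q y \<partial>lborel) / r) \<longlongrightarrow> 0) (at_right 0)"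
         "((\<lambda>r. (\<integral>y\<in>cball x r. \<psi> n p y \<partial>lborel) / r) \<longlongrightarrow> 0) (at_right 0)"
        using elim by auto
      have "\<forall>\<^sub>F r in at_right 0. (\<integral>y\<in>cball x r. \<phi> n q y \<partial>lborel) / r < e / 8"
        using lim(1) e by (intro order_tendstoD) auto
      moreover have "\<forall>\<^sub>F r in at_right 0. (\<integral>y\<in>cball x r. \<psi> n p y \<partial>lborel) / r < e / 8"
        using lim(2) e by (intro order_tendstoD) auto
      moreover have "\<forall>\<^sub>F r in at_right (0::real). 0 < r \<and> r \<le> 1"
        by (auto simp: eventually_at_right_field intro!: exI[of _ 1])
      ultimately show "\<forall>\<^sub>F r in at_right 0. dist ((\<integral>y\<in>cball x r. \<bar>g y - g x\<bar> \<partial>lborel) / r) 0 < e"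
      proof eventually_elim
        case (elim r)
        let ?B = "cball x r"
        have i: "set_integrable lborel ?B (\<phi> n q)" "set_integrable lborel ?B (\<psi> n p)"
          unfolding set_integrable_def
          by (intro integrable_mult_indicator i\<phi> i\<psi>; simp)+
        have ic: "set_integrable lborel ?B (\<lambda>_. e / 4)" 
          unfolding set_integrable_def cball_eq_atLeastAtMost real_scaleR_def
          by (rule integrable_mult_left) (use elim in simp)
        have "(\<integral>y\<in>?B. \<bar>g y - g x\<bar> \<partial>lborel) \<le> (\<integral>y\<in>?B. (\<phi> n q y + \<psi> n p y) + e / 4 \<partial>lborel)"
          unfolding set_lebesgue_integral_def
        proof (rule integral_mono_AE')
          show "integrable lborel (\<lambda>y. indicat_real ?B y *\<^sub>R ((\<phi> n q y + \<psi> n p y) + e / 4))"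
            using i ic unfolding set_integrable_def[symmetric] by (intro set_integral_add) auto
          show "AE y in lborel. indicat_real ?B y *\<^sub>R \<bar>g y - g x\<bar> \<le>
              indicat_real ?B y *\<^sub>R ((\<phi> n q y + \<psi> n p y) + e / 4)"
          proof (rule AE_I2)
            fix y
            show "indicat_real ?B y *\<^sub>R \<bar>g y - g x\<bar> \<le>
              indicat_real ?B y *\<^sub>R ((\<phi> n q y + \<psi> n p y) + e / 4)"
            proof (cases "y \<in> ?B")
              case True
              then have "\<bar>x - y\<bar> \<le> 1" using elim by (auto simp: dist_real_def)
              then have "y \<in> I n" using n by (auto simp: I_def)
              then show ?thesis using True p q by (auto simp: \<phi>_def \<psi>_def)
            qed auto
          qed
        qed (use e in \<open>auto intro!: AE_I2 simp: \<phi>_def \<psi>_def\<close>)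
        also have "\<dots> = (\<integral>y\<in>?B. \<phi> n q y \<partial>lborel) + (\<integral>y\<in>?B. \<psi> n p y \<partial>lborel) + (\<integral>y\<in>?B. e / 4 \<partial>lborel)"
          using i ic by (simp add: set_integral_add)
        also have "(\<integral>y\<in>?B. e / 4 \<partial>lborel) = r * e / 2"
          using elim by (simp add: set_lebesgue_integral_def cball_eq_atLeastAtMost)
        also have "(\<integral>y\<in>?B. \<phi> n q y \<partial>lborel) < r * e / 8"
          using elim by (simp add: field_simps)
        also have "(\<integral>y\<in>?B. \<psi> n p y \<partial>lborel) < r * e / 8"
          using elim by (simp add: field_simps)
        also have "r * e / 8 + r * e / 8 + r * e / 2 < r * e"
          using elim e mult_pos_pos[of r e] by linarith
        finally have "(\<integral>y\<in>?B. \<bar>g y - g x\<bar> \<partial>lborel) < r * e" by simp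
        moreover have "0 \<le> (\<integral>y\<in>?B. \<bar>g y - g x\<bar> \<partial>lborel)"
          unfolding set_lebesgue_integral_def by (intro integral_nonneg_AE) auto
        ultimately show ?case using elim by (simp add: field_simps)
      qed
    qed
  qed
qed

section \<open>Radially decreasing approximate identities\<close>

text \<open>Tonelli, with \<open>u x\<close> written as the length of
  \<open>{0..<u x}\<close>.\<close>

lemma nn_integral_layer_cake:
  assumes "sigma_finite_measure N" and [measurable]: "u \<in> borel_measurable N" and nn: "\<And>x. 0 \<le> u x"
  shows "(\<integral>\<^sup>+x. ennreal (u x) \<partial>N) = (\<integral>\<^sup>+s. indicator {0..} s * emeasure N {x \<in> space N. s < u x} \<partial>lborel)"
proof -
  interpret N: sigma_finite_measure N by (rule assms)
  interpret pair_sigma_finite N lborel ..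
  define k :: "'a \<times> real \<Rightarrow> ennreal" where "k = (\<lambda>(x, s). indicator {p. 0 \<le> snd p \<and> snd p < u (fst p)} (x, s))"
  have [measurable]: "k \<in> borel_measurable (N \<Otimes>\<^sub>M lborel)"
    unfolding k_def by measurable
  have "(\<integral>\<^sup>+x. ennreal (u x) \<partial>N) = (\<integral>\<^sup>+x. (\<integral>\<^sup>+s. k (x, s) \<partial>lborel) \<partial>N)"
  proof (rule nn_integral_cong)
    fix x
    have "(\<integral>\<^sup>+s. k (x, s) \<partial>lborel) = (\<integral>\<^sup>+s. indicator {0..<u x} s \<partial>lborel)"
      by (intro nn_integral_cong) (auto simp: k_def split: split_indicator)
    then show "ennreal (u x) = (\<integral>\<^sup>+s. k (x, s) \<partial>lborel)" using nn by simp
  qed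
  also have "\<dots> = (\<integral>\<^sup>+s. (\<integral>\<^sup>+x. k (x, s) \<partial>N) \<partial>lborel)"
    by (rule Fubini'[symmetric, where f = "\<lambda>x s. k (x, s)"]) simp
  also have "\<dots> = (\<integral>\<^sup>+s. indicator {0..} s * emeasure N {x \<in> space N. s < u x} \<partial>lborel)"
  proof (rule nn_integral_cong)
    fix s :: real
    have "(\<integral>\<^sup>+x. k (x, s) \<partial>N) = (\<integral>\<^sup>+x. indicator {0..} s * indicator {x \<in> space N. s < u x} x \<partial>N)"
      by (intro nn_integral_cong) (auto simp: k_def split: split_indicator)
    then show "(\<integral>\<^sup>+x. k (x, s) \<partial>N) = indicator {0..} s * emeasure N {x \<in> space N. s < u x}"
      by (simp add: nn_integral_cmult)
  qed
  finally show ?thesis .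
qed

text \<open>Reduces a comparison of integrals to sets. For a radially decreasing \<open>u\<close>
  the sets are centred intervals, the only ones on which a derivative of a measure gives
  information.\<close>

lemma nn_integral_le_of_superlevel_sets:
  assumes "sigma_finite_measure N" "sigma_finite_measure N'"
    and "u \<in> borel_measurable N" "u \<in> borel_measurable N'" and nn: "\<And>x. 0 \<le> u x"
    and le: "\<And>s. 0 \<le> s \<Longrightarrow>
      emeasure N {x \<in> space N. s < u x} \<le> c * emeasure N' {x \<in> space N'. s < u x}"
  shows "(\<integral>\<^sup>+x. ennreal (u x) \<partial>N) \<le> c * (\<integral>\<^sup>+x. ennreal (u x) \<partial>N')"
proof -
  interpret N': sigma_finite_measure N' by (rule assms)
  interpret pair_sigma_finite lborel N' ..
  have [measurable]: "u \<in> borel_measurable N'" by (rule assms)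
  \<comment> \<open>Measurability of the superlevel mass in \<open>s\<close> is what allows
    \<open>c\<close> to be moved out of the outer integral.\<close>
  have "(\<lambda>s. \<integral>\<^sup>+x. indicator {p. fst p < u (snd p)} (s, x) \<partial>N') \<in> borel_measurable lborel"
    by (rule N'.borel_measurable_nn_integral) measurable
  moreover have "(\<integral>\<^sup>+x. indicator {p. fst p < u (snd p)} (s, x) \<partial>N') = emeasure N' {x \<in> space N'. s < u x}" for s
  proof -
    have "(\<integral>\<^sup>+x. indicator {p. fst p < u (snd p)} (s, x) \<partial>N') =
        (\<integral>\<^sup>+x. indicator {x \<in> space N'. s < u x} x \<partial>N')"
      by (intro nn_integral_cong) (auto split: split_indicator)
    then show ?thesis by simp
  qed
  ultimately have [measurable]: "(\<lambda>s. emeasure N' {x \<in> space N'. s < u x}) \<in> borel_measurable borel"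
    by simp
  show ?thesis
    unfolding nn_integral_layer_cake[OF assms(1,3) nn] nn_integral_layer_cake[OF assms(2,4) nn]
    by (subst nn_integral_cmult[symmetric]) (auto intro!: nn_integral_mono le split: split_indicator)
qed

lemma lborel_integral_scaled:
  fixes k :: "real \<Rightarrow> real"
  assumes "0 < \<sigma>"
  shows "(\<integral>x. k ((x - x0) / \<sigma>) \<partial>lborel) = \<sigma> * (\<integral>v. k v \<partial>lborel)"
proof -
  have "(\<integral>v. k v \<partial>lborel) = (1 / \<sigma>) * (\<integral>x. k (- x0 / \<sigma> + 1 / \<sigma> * x) \<partial>lborel)"
    using lborel_integral_real_affine[of "1 / \<sigma>" k "- x0 / \<sigma>"] assms by simp
  then show ?thesis using assms by (simp add: diff_divide_distrib add.commute)
qed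

lemma lborel_integral_reflect:
  fixes k :: "real \<Rightarrow> real"
  shows "(\<integral>v. k (z - v) \<partial>lborel) = (\<integral>u. k u \<partial>lborel)"
  using lborel_integral_real_affine[of "-1" k z] by simp

text \<open>A kernel enters the estimates only through a bound by \<open>G \<bar>v\<bar>\<close>.
  Monotonicity serves twice: it makes superlevel sets centred intervals, and together with
  integrability it forces decay faster than 1 / R.\<close>

locale radial_majorant =
  fixes G :: "real \<Rightarrow> real"
  assumes antimono: "antimono G"
    and nonneg: "0 \<le> G r"
    and integrable: "integrable lborel (\<lambda>v. G \<bar>v\<bar>)"
begin

lemma measurable_G [measurable]: "G \<in> borel_measurable borel"
proof -
  have "(\<lambda>r. - (- G r)) \<in> borel_measurable borel"
    using antimono by (intro borel_measurable_uminus borel_measurable_mono) (auto simp: mono_def antimono_def)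
  then show ?thesis by simp
qed

lemma tail_integral_tendsto:
  "((\<lambda>R. \<integral>v. indicator {v. R < \<bar>v\<bar>} v * G \<bar>v\<bar> \<partial>lborel) \<longlongrightarrow> 0) at_top"
proof -
  have "((\<lambda>R. \<integral>v. indicator {v. R < \<bar>v\<bar>} v * G \<bar>v\<bar> \<partial>lborel) \<longlongrightarrow> (\<integral>v. 0 \<partial>(lborel :: real measure))) at_top"
  proof (rule integral_dominated_convergence_at_top[where w = "\<lambda>v. G \<bar>v\<bar>"])
    show "AE v in lborel. ((\<lambda>R. indicator {v. R < \<bar>v\<bar>} v * G \<bar>v\<bar>) \<longlongrightarrow> 0) at_top"
    proof (rule AE_I2)
      fix v :: real
      have "\<forall>\<^sub>F R in at_top. indicator {v. R < \<bar>v\<bar>} v * G \<bar>v\<bar> = 0"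
        using eventually_ge_at_top[of "\<bar>v\<bar>"] by eventually_elim auto
      then show "((\<lambda>R. indicator {v. R < \<bar>v\<bar>} v * G \<bar>v\<bar>) \<longlongrightarrow> 0) at_top"
        by (rule tendsto_eventually)
    qed
  qed (auto simp: integrable nonneg split: split_indicator)
  then show ?thesis by simp
qed

text \<open>By monotonicity R / 2 * G R is at most the integral of \<open>G\<close> over
  \<open>{R / 2<..R}\<close>, which is part of a tail of a convergent integral.\<close>

lemma mult_G_tendsto: "((\<lambda>R. R * G R) \<longlongrightarrow> 0) at_top"
proof (rule tendsto_sandwich[where f = "\<lambda>_. 0"])
  have half: "filterlim (\<lambda>R::real. R / 2) at_top at_top"
    by (rule filterlim_at_top_mult_tendsto_pos[where c = "1/2" and f = "\<lambda>_. 1/2" and g = "\<lambda>R. R", simplified]) 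
       (auto intro: filterlim_ident)
  show "((\<lambda>R. 2 * (\<integral>v. indicator {v. R / 2 < \<bar>v\<bar>} v * G \<bar>v\<bar> \<partial>lborel)) \<longlongrightarrow> 0) at_top"
    using tendsto_mult_right_zero[OF filterlim_compose[OF tail_integral_tendsto half]] by simp
  show "\<forall>\<^sub>F R in at_top. R * G R \<le> 2 * (\<integral>v. indicator {v. R / 2 < \<bar>v\<bar>} v * G \<bar>v\<bar> \<partial>lborel)"
    using eventually_gt_at_top[of 0]
  proof eventually_elim
    case (elim R)
    have "R / 2 * G R = (\<integral>v. indicator {R / 2<..R} v * G R \<partial>lborel)"
      using elim by simp
    also have "\<dots> \<le> (\<integral>v. indicator {v. R / 2 < \<bar>v\<bar>} v * G \<bar>v\<bar> \<partial>lborel)"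
    proof (rule integral_mono_AE')
      show "integrable lborel (\<lambda>v. indicator {v. R / 2 < \<bar>v\<bar>} v * G \<bar>v\<bar>)"
        by (rule Bochner_Integration.integrable_bound[OF integrable]) (auto split: split_indicator)
    qed (use elim nonneg antimonoD[OF antimono] in \<open>auto split: split_indicator\<close>)
    finally show ?case by simp
  qed
  show "\<forall>\<^sub>F R in at_top. 0 \<le> R * G R"
    using eventually_gt_at_top[of 0] by eventually_elim (simp add: nonneg)
qed simp

lemma G_tendsto: "(G \<longlongrightarrow> 0) at_top"
proof (rule tendsto_sandwich[OF _ _ tendsto_const mult_G_tendsto])
  show "\<forall>\<^sub>F R in at_top. G R \<le> R * G R"
    using eventually_ge_at_top[of 1] by eventually_elim (use mult_right_mono[OF _ nonneg, of 1] in auto)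
qed (simp add: nonneg)

lemma scaled_integrable:
  assumes "0 < \<sigma>"
  shows "integrable lborel (\<lambda>x. G (\<bar>x - x0\<bar> / \<sigma>))"
  using lborel_integrable_real_affine[OF integrable, of "1 / \<sigma>" "- x0 / \<sigma>"] assms
  by (simp add: abs_divide diff_divide_distrib[symmetric] add.commute)

text \<open>The cut-off at \<gamma> keeps every superlevel set inside the range of radii where
  \<open>dens\<close> is available.\<close>

lemma nn_integral_near_le:
  fixes \<nu> :: "real measure"
  assumes fin: "finite_measure \<nu>" and sets[measurable_cong]: "sets \<nu> = sets borel"
    and \<sigma>: "0 < \<sigma>" and \<epsilon>: "0 < \<epsilon>" and \<gamma>: "0 < \<gamma>"
    and dens: "\<And>r. 0 < r \<Longrightarrow> r \<le> \<gamma> \<Longrightarrow> measure \<nu> (cball x0 r) \<le> \<epsilon> * r"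
  shows "(\<integral>\<^sup>+x. ennreal (indicator (cball x0 \<gamma>) x * G (\<bar>x - x0\<bar> / \<sigma>)) \<partial>\<nu>)
    \<le> ennreal \<epsilon> * (\<integral>\<^sup>+x. ennreal (indicator (cball x0 \<gamma>) x * G (\<bar>x - x0\<bar> / \<sigma>)) \<partial>lborel)"
proof (rule nn_integral_le_of_superlevel_sets)
  interpret finite_measure \<nu> by (rule fin)
  have u: "(\<lambda>x. indicator (cball x0 \<gamma>) x * G (\<bar>x - x0\<bar> / \<sigma>)) \<in> borel_measurable borel"
    by (intro borel_measurable_times borel_measurable_indicator) auto
  then show "(\<lambda>x. indicator (cball x0 \<gamma>) x * G (\<bar>x - x0\<bar> / \<sigma>)) \<in> borel_measurable \<nu>"
    "(\<lambda>x. indicator (cball x0 \<gamma>) x * G (\<bar>x - x0\<bar> / \<sigma>)) \<in> borel_measurable lborel"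
    by (simp_all cong: measurable_cong_sets add: sets)
  show "sigma_finite_measure \<nu>" ..
  show "sigma_finite_measure (lborel :: real measure)" ..
  have sp: "space \<nu> = UNIV" using sets_eq_imp_space_eq[OF sets] by simp
  fix s :: real assume s: "0 \<le> s"
  define I where "I = {x. s < indicator (cball x0 \<gamma>) x * G (\<bar>x - x0\<bar> / \<sigma>)}"
  have [measurable]: "I \<in> sets borel" unfolding I_def using u by measurable
  have I_iff: "x \<in> I \<longleftrightarrow> \<bar>x - x0\<bar> \<le> \<gamma> \<and> s < G (\<bar>x - x0\<bar> / \<sigma>)" for x
    using s by (auto simp: I_def dist_real_def abs_minus_commute split: split_indicator)
  have "emeasure \<nu> I \<le> ennreal \<epsilon> * emeasure lborel I"
  proof (cases "I = {}")
    case False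
    \<comment> \<open>\<open>I\<close> is a centred interval since \<open>G\<close> is decreasing.\<close>
    define D where "D = (\<lambda>x. \<bar>x - x0\<bar>) ` I"
    define \<rho> where "\<rho> = Sup D"
    have D: "D \<noteq> {}" "bdd_above D" using False I_iff by (auto simp: D_def intro!: bdd_aboveI[of _ \<gamma>])
    have upper: "\<bar>x - x0\<bar> \<le> \<rho>" if "x \<in> I" for x
      unfolding \<rho>_def using that D by (intro cSup_upper) (auto simp: D_def)
    have \<rho>: "0 \<le> \<rho>" "\<rho> \<le> \<gamma>"
      using upper False D I_iff by (force, auto simp: \<rho>_def D_def intro!: cSup_least)
    have ball: "ball x0 \<rho> \<subseteq> I"
    proof
      fix y assume "y \<in> ball x0 \<rho>"
      then have "\<bar>y - x0\<bar> < Sup D" by (simp add: \<rho>_def dist_real_def abs_minus_commute)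
      then obtain x where x: "x \<in> I" "\<bar>y - x0\<bar> < \<bar>x - x0\<bar>"
        using less_cSup_iff[OF D] by (auto simp: D_def)
      then have "G (\<bar>x - x0\<bar> / \<sigma>) \<le> G (\<bar>y - x0\<bar> / \<sigma>)"
        using \<sigma> by (intro antimonoD[OF antimono] divide_right_mono) auto
      then show "y \<in> I" using x unfolding I_iff by auto
    qed
    \<comment> \<open>\<open>I\<close> lies between the open and the closed ball of radius \<rho>.
      The closed one bounds its \<nu>-mass from above, the open one its length from below, so it
      does not matter which end points belong to \<open>I\<close>.\<close>
    have cball: "I \<subseteq> cball x0 \<rho>" using upper by (auto simp: dist_real_def abs_minus_commute)
    have le: "emeasure \<nu> I \<le> measure \<nu> (cball x0 \<rho>)"
      unfolding emeasure_eq_measure using cball by (intro ennreal_leI finite_measure_mono) (auto simp: sets)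
    show ?thesis
    proof (cases "\<rho> = 0")
      case True
      \<comment> \<open>Here \<open>I\<close> is the single point \<open>x0\<close>, of length 0, so
        \<nu> must not charge it. Letting r tend to 0 in \<open>dens\<close> shows this; the chosen
        \<open>r\<close> makes the bound at most half of the supposed mass.\<close>
      have "measure \<nu> {x0} = 0"
      proof (rule ccontr)
        assume "measure \<nu> {x0} \<noteq> 0"
        then have p: "0 < measure \<nu> {x0}" by (simp add: zero_less_measure_iff)
        define r where "r = min \<gamma> (measure \<nu> {x0} / (2 * \<epsilon>))"
        have r: "0 < r" "r \<le> \<gamma>" "r \<le> measure \<nu> {x0} / (2 * \<epsilon>)" using p \<gamma> \<epsilon> by (auto simp: r_def)
        have "measure \<nu> {x0} \<le> measure \<nu> (cball x0 r)"
          using r by (intro finite_measure_mono) (auto simp: sets)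
        also have "\<dots> \<le> \<epsilon> * r" using dens r by auto
        also have "\<dots> \<le> measure \<nu> {x0} / 2" using r \<epsilon> by (simp add: field_simps)
        finally show False using p by simp
      qed
      then show ?thesis using le True by simp
    next
      case False
      then have pos: "0 < \<rho>" using \<rho> by simp
      have "emeasure \<nu> I \<le> ennreal (\<epsilon> * \<rho>)"
        using le dens[OF pos \<rho>(2)] by (meson ennreal_leI order_trans)
      also have "\<dots> \<le> ennreal (\<epsilon> * (2 * \<rho>))" using pos \<epsilon> by (intro ennreal_leI) auto
      also have "\<dots> = ennreal \<epsilon> * emeasure lborel (ball x0 \<rho>)"
        using pos \<epsilon> by (simp add: ball_eq_greaterThanLessThan ennreal_mult)
      also have "\<dots> \<le> ennreal \<epsilon> * emeasure lborel I"
        using ball by (intro mult_left_mono emeasure_mono) auto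
      finally show ?thesis .
    qed
  qed simp
  then show "emeasure \<nu> {x \<in> space \<nu>. s < indicator (cball x0 \<gamma>) x * G (\<bar>x - x0\<bar> / \<sigma>)} \<le>
      ennreal \<epsilon> * emeasure lborel {x \<in> space lborel. s < indicator (cball x0 \<gamma>) x * G (\<bar>x - x0\<bar> / \<sigma>)}"
    by (simp add: I_def sp)
qed (simp add: nonneg)

text \<open>Within distance \<gamma> of \<open>x0\<close> the comparison with Lebesgue measure gives
  at most \<epsilon> * \<sigma> * J. Farther out the kernel is at most G (\<gamma> / \<sigma>),
  which is o(\<sigma>) for fixed \<gamma>.\<close>

lemma integral_zero_density_tendsto:
  fixes \<nu> :: "real measure"
  assumes fin: "finite_measure \<nu>" and sets[measurable_cong]: "sets \<nu> = sets borel"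
    and dens: "((\<lambda>r. measure \<nu> (cball x0 r) / r) \<longlongrightarrow> 0) (at_right 0)"
  shows "((\<lambda>\<sigma>. (\<integral>x. G (\<bar>x - x0\<bar> / \<sigma>) \<partial>\<nu>) / \<sigma>) \<longlongrightarrow> 0) (at_right 0)"
proof (rule tendstoI)
  fix e :: real assume e: "0 < e"
  interpret finite_measure \<nu> by (rule fin)
  define J where "J = (\<integral>v. G \<bar>v\<bar> \<partial>lborel)"
  have J: "0 \<le> J" unfolding J_def by (intro integral_nonneg_AE) (simp add: nonneg)
  \<comment> \<open>The added 1 avoids division by zero when \<open>J\<close> vanishes and still
    gives \<epsilon> * J < e / 2.\<close>
  define \<epsilon> where "\<epsilon> = e / (2 * (J + 1))"
  have \<epsilon>: "0 < \<epsilon>" "\<epsilon> * J < e / 2" using e J by (auto simp: \<epsilon>_def field_simps)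
  have "\<forall>\<^sub>F r in at_right 0. measure \<nu> (cball x0 r) / r < \<epsilon>"
    using dens \<epsilon> by (intro order_tendstoD) auto
  then obtain b where b: "0 < b" "\<And>r. 0 < r \<Longrightarrow> r < b \<Longrightarrow> measure \<nu> (cball x0 r) / r < \<epsilon>"
    by (auto simp: eventually_at_right_field)
  define \<gamma> where "\<gamma> = b / 2"
  have \<gamma>: "0 < \<gamma>" "\<And>r. 0 < r \<Longrightarrow> r \<le> \<gamma> \<Longrightarrow> measure \<nu> (cball x0 r) \<le> \<epsilon> * r"
    using b(1) b(2)[THEN less_imp_le] by (auto simp: \<gamma>_def pos_divide_le_eq)
  define m where "m = measure \<nu> (space \<nu>)"
  have "filterlim (\<lambda>\<sigma>. \<gamma> / \<sigma>) at_top (at_right 0)"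
    unfolding divide_inverse using \<gamma>(1)
    by (intro filterlim_tendsto_pos_mult_at_top[OF tendsto_const _ filterlim_inverse_at_top_right])
  then have "((\<lambda>\<sigma>. (\<gamma> / \<sigma> * G (\<gamma> / \<sigma>)) * (m / \<gamma>)) \<longlongrightarrow> 0 * (m / \<gamma>)) (at_right 0)"
    by (intro tendsto_mult tendsto_const filterlim_compose[OF mult_G_tendsto])
  then have "\<forall>\<^sub>F \<sigma> in at_right 0. (\<gamma> / \<sigma> * G (\<gamma> / \<sigma>)) * (m / \<gamma>) < e / 2"
    using e by (intro order_tendstoD) auto
  moreover have "\<forall>\<^sub>F \<sigma> in at_right (0::real). 0 < \<sigma>" by (rule eventually_at_right_less)
  ultimately show "\<forall>\<^sub>F \<sigma> in at_right 0. dist ((\<integral>x. G (\<bar>x - x0\<bar> / \<sigma>) \<partial>\<nu>) / \<sigma>) 0 < e"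
  proof eventually_elim
    case (elim \<sigma>)
    note \<sigma> = elim(2)
    define u where "u x = indicator (cball x0 \<gamma>) x * G (\<bar>x - x0\<bar> / \<sigma>)" for x
    have [measurable]: "u \<in> borel_measurable borel"
      unfolding u_def by (intro borel_measurable_times borel_measurable_indicator) auto
    have u0: "0 \<le> u x" for x by (simp add: u_def nonneg)
    have GG: "G (\<bar>x - x0\<bar> / \<sigma>) \<le> G 0" for x using \<sigma> by (intro antimonoD[OF antimono]) auto
    have iG: "integrable \<nu> (\<lambda>x. G (\<bar>x - x0\<bar> / \<sigma>))"
      using GG nonneg by (intro integrable_const_bound[of _ "G 0"]) auto
    have iu: "integrable \<nu> u"
      by (rule Bochner_Integration.integrable_bound[OF iG]) (auto simp: u_def split: split_indicator)
    have iul: "integrable lborel u"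
      by (rule Bochner_Integration.integrable_bound[OF scaled_integrable[OF \<sigma>, of x0]])
        (auto simp: u_def split: split_indicator)
    have "ennreal (\<integral>x. u x \<partial>\<nu>) = (\<integral>\<^sup>+x. u x \<partial>\<nu>)"
      using iu u0 by (intro nn_integral_eq_integral[symmetric]) auto
    also have "\<dots> \<le> \<epsilon> * (\<integral>\<^sup>+x. u x \<partial>lborel)"
      unfolding u_def by (rule nn_integral_near_le[OF fin sets \<sigma> \<epsilon>(1) \<gamma>])
    also have "(\<integral>\<^sup>+x. u x \<partial>lborel) = ennreal (\<integral>x. u x \<partial>lborel)"
      using iul u0 by (intro nn_integral_eq_integral) auto
    also have "ennreal \<epsilon> * \<dots> = ennreal (\<epsilon> * (\<integral>x. u x \<partial>lborel))"
      using \<epsilon> u0 by (intro ennreal_mult[symmetric] integral_nonneg_AE) auto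
    finally have "(\<integral>x. u x \<partial>\<nu>) \<le> \<epsilon> * (\<integral>x. u x \<partial>lborel)"
      using \<epsilon> u0 by (subst (asm) ennreal_le_iff) (auto intro!: mult_nonneg_nonneg integral_nonneg_AE)
    also have "(\<integral>x. u x \<partial>lborel) \<le> (\<integral>x. G (\<bar>x - x0\<bar> / \<sigma>) \<partial>lborel)"
      by (intro integral_mono iul scaled_integrable \<sigma>) (auto simp: u_def nonneg split: split_indicator)
    also have "\<dots> = \<sigma> * J"
      using lborel_integral_scaled[OF \<sigma>, of "\<lambda>v. G \<bar>v\<bar>" x0] \<sigma> by (simp add: J_def abs_divide)
    finally have near: "(\<integral>x. u x \<partial>\<nu>) \<le> \<epsilon> * (\<sigma> * J)" using \<epsilon> by simp
    have "(\<integral>x. G (\<bar>x - x0\<bar> / \<sigma>) \<partial>\<nu>) \<le> (\<integral>x. u x + G (\<gamma> / \<sigma>) \<partial>\<nu>)"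
    proof (rule integral_mono[OF iG])
      show "integrable \<nu> (\<lambda>x. u x + G (\<gamma> / \<sigma>))" using iu by simp
      show "G (\<bar>x - x0\<bar> / \<sigma>) \<le> u x + G (\<gamma> / \<sigma>)" for x
      proof (cases "x \<in> cball x0 \<gamma>")
        case True
        then show ?thesis by (simp add: u_def nonneg)
      next
        case False
        then have "\<gamma> / \<sigma> \<le> \<bar>x - x0\<bar> / \<sigma>"
          using \<sigma> by (intro divide_right_mono) (auto simp: dist_real_def)
        then show ?thesis using False antimonoD[OF antimono] by (simp add: u_def)
      qed
    qed
    also have "\<dots> = (\<integral>x. u x \<partial>\<nu>) + m * G (\<gamma> / \<sigma>)" using iu by (simp add: m_def)
    finally have "(\<integral>x. G (\<bar>x - x0\<bar> / \<sigma>) \<partial>\<nu>) \<le> \<epsilon> * (\<sigma> * J) + m * G (\<gamma> / \<sigma>)"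
      using near by simp
    then have "(\<integral>x. G (\<bar>x - x0\<bar> / \<sigma>) \<partial>\<nu>) / \<sigma> \<le> (\<epsilon> * (\<sigma> * J) + m * G (\<gamma> / \<sigma>)) / \<sigma>"
      using \<sigma> by (intro divide_right_mono) auto
    also have "\<dots> = \<epsilon> * J + (\<gamma> / \<sigma> * G (\<gamma> / \<sigma>)) * (m / \<gamma>)"
      using \<sigma> \<gamma>(1) by (simp add: field_simps)
    finally have "(\<integral>x. G (\<bar>x - x0\<bar> / \<sigma>) \<partial>\<nu>) / \<sigma> < e" using elim \<epsilon> by linarith
    moreover have "0 \<le> (\<integral>x. G (\<bar>x - x0\<bar> / \<sigma>) \<partial>\<nu>) / \<sigma>"
      using \<sigma> by (intro divide_nonneg_pos integral_nonneg_AE) (auto simp: nonneg)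
    ultimately show ?case by simp
  qed
qed

lemma abs_le_G0:
  fixes k :: "real \<Rightarrow> real"
  assumes "\<And>v. \<bar>k v\<bar> \<le> G \<bar>v\<bar>"
  shows "\<bar>k v\<bar> \<le> G 0"
  using assms[of v] antimonoD[OF antimono, of 0 "\<bar>v\<bar>"] by simp

text \<open>Dominated convergence with the constant bound \<open>G 0\<close>: off \<open>x0\<close>
  the argument of the kernel runs to infinity, where \<open>G\<close> vanishes. The scale is 1, not
  \<sigma>, since an atom keeps its mass in every ball.\<close>

lemma integral_atom_tendsto:
  fixes X :: "'a \<Rightarrow> real" and k :: "real \<Rightarrow> real"
  assumes "finite_measure M" and [measurable]: "X \<in> borel_measurable M" "k \<in> borel_measurable borel"
    and k: "\<And>v. \<bar>k v\<bar> \<le> G \<bar>v\<bar>"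
  shows "((\<lambda>\<sigma>. \<integral>\<omega>. k ((X \<omega> - x0) / \<sigma>) \<partial>M) \<longlongrightarrow> k 0 * measure M {\<omega> \<in> space M. X \<omega> = x0}) (at_right 0)"
proof -
  interpret finite_measure M by (rule assms)
  define A where "A = {\<omega> \<in> space M. X \<omega> = x0}"
  have [measurable]: "A \<in> sets M" unfolding A_def by measurable
  \<comment> \<open>The substitution t = 1 / \<sigma> turns the limit at 0 into one at
    infinity.\<close>
  have "((\<lambda>t. \<integral>\<omega>. k ((X \<omega> - x0) * t) \<partial>M) \<longlongrightarrow> (\<integral>\<omega>. indicator A \<omega> * k 0 \<partial>M)) at_top"
  proof (rule integral_dominated_convergence_at_top[where w = "\<lambda>_. G 0"])
    show "\<forall>\<^sub>F t in at_top. AE \<omega> in M. norm (k ((X \<omega> - x0) * t)) \<le> G 0"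
      using abs_le_G0[OF k] by simp
    show "AE \<omega> in M. ((\<lambda>t. k ((X \<omega> - x0) * t)) \<longlongrightarrow> indicator A \<omega> * k 0) at_top"
    proof (rule AE_I2)
      fix \<omega> assume \<omega>: "\<omega> \<in> space M"
      show "((\<lambda>t. k ((X \<omega> - x0) * t)) \<longlongrightarrow> indicator A \<omega> * k 0) at_top"
      proof (cases "X \<omega> = x0")
        case True
        then show ?thesis using \<omega> by (simp add: A_def)
      next
        case False
        then have "filterlim (\<lambda>t. \<bar>X \<omega> - x0\<bar> * t) at_top at_top"
          by (intro filterlim_tendsto_pos_mult_at_top[OF tendsto_const] filterlim_ident) auto
        then have "((\<lambda>t. G (\<bar>X \<omega> - x0\<bar> * t)) \<longlongrightarrow> 0) at_top"
          by (rule filterlim_compose[OF G_tendsto])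
        moreover have "\<forall>\<^sub>F t in at_top. norm (k ((X \<omega> - x0) * t)) \<le> G (\<bar>X \<omega> - x0\<bar> * t)"
          using eventually_ge_at_top[of 0]
        proof eventually_elim
          case (elim t)
          then show ?case using k[of "(X \<omega> - x0) * t"] by (simp add: abs_mult)
        qed
        ultimately have "((\<lambda>t. k ((X \<omega> - x0) * t)) \<longlongrightarrow> 0) at_top"
          by (rule Lim_null_comparison[rotated])
        then show ?thesis using False by (simp add: A_def)
      qed
    qed
  qed auto
  then show ?thesis
    unfolding filterlim_at_right_to_top by (simp add: A_def divide_inverse mult.commute)
qed

text \<open>At a Lebesgue point the measure with density |g - g x0|, cut off at distance 1, has
  derivative 0, so replacing \<open>g\<close> by the constant \<open>g x0\<close> near
  \<open>x0\<close> costs o(\<sigma>).\<close>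

lemma integral_Lebesgue_point_tendsto:
  fixes g k :: "real \<Rightarrow> real"
  assumes g: "integrable lborel g"
    and pt: "((\<lambda>r. (\<integral>y\<in>cball x0 r. \<bar>g y - g x0\<bar> \<partial>lborel) / r) \<longlongrightarrow> 0) (at_right 0)"
    and [measurable]: "k \<in> borel_measurable borel" and k: "\<And>v. \<bar>k v\<bar> \<le> G \<bar>v\<bar>"
  shows "((\<lambda>\<sigma>. (\<integral>x. k ((x - x0) / \<sigma>) * g x \<partial>lborel) / \<sigma>) \<longlongrightarrow> g x0 * (\<integral>v. k v \<partial>lborel)) (at_right 0)"
proof -
  have [measurable]: "g \<in> borel_measurable borel" using g by auto
  define c where "c = g x0"
  \<comment> \<open>Radius 1 is an arbitrary fixed cut-off; it makes the constant \<open>c\<close>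
    integrable.\<close>
  define w where "w x = indicator (cball x0 1) x * \<bar>g x - c\<bar>" for x
  have w0: "0 \<le> w x" for x by (simp add: w_def)
  have ic: "integrable lborel (\<lambda>x. indicator (cball x0 1) x * c)"
    by (intro integrable_mult_left) (auto simp: cball_eq_atLeastAtMost)
  have "integrable lborel (\<lambda>x. indicator (cball x0 1) x * g x)"
    using integrable_mult_indicator[OF _ g, of "cball x0 1"] by simp
  from Bochner_Integration.integrable_diff[OF this ic]
  have "integrable lborel (\<lambda>x. indicator (cball x0 1) x * (g x - c))" by (simp add: right_diff_distrib)
  then have iw: "integrable lborel w"
    unfolding w_def by (drule_tac integrable_abs) (simp add: abs_mult)
  have [measurable]: "w \<in> borel_measurable borel" using iw by auto
  define \<nu> where "\<nu> = density lborel (\<lambda>x. ennreal (w x))"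
  have near: "((\<lambda>\<sigma>. (\<integral>x. G (\<bar>x - x0\<bar> / \<sigma>) \<partial>\<nu>) / \<sigma>) \<longlongrightarrow> 0) (at_right 0)"
  proof (rule integral_zero_density_tendsto)
    show "finite_measure \<nu>" unfolding \<nu>_def by (rule finite_measure_density_integrable[OF iw w0])
    have "\<forall>\<^sub>F r in at_right 0. (\<integral>y\<in>cball x0 r. \<bar>g y - g x0\<bar> \<partial>lborel) / r = measure \<nu> (cball x0 r) / r"
      unfolding eventually_at_right_field
    proof (intro exI[of _ 1] conjI allI impI)
      fix r :: real assume "0 < r" "r < 1"
      then have "(\<integral>y\<in>cball x0 r. \<bar>g y - g x0\<bar> \<partial>lborel) = (\<integral>y\<in>cball x0 r. w y \<partial>lborel)"
        unfolding set_lebesgue_integral_def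
        by (intro Bochner_Integration.integral_cong) (auto simp: w_def c_def split: split_indicator)
      then show "(\<integral>y\<in>cball x0 r. \<bar>g y - g x0\<bar> \<partial>lborel) / r = measure \<nu> (cball x0 r) / r"
        unfolding \<nu>_def by (subst measure_density_integrable[OF iw w0]) auto
    qed simp
    with pt show "((\<lambda>r. measure \<nu> (cball x0 r) / r) \<longlongrightarrow> 0) (at_right 0)"
      by (rule Lim_transform_eventually)
  qed (simp add: \<nu>_def)
  have inv: "filterlim (\<lambda>\<sigma>::real. 1 / \<sigma>) at_top (at_right 0)"
    using filterlim_inverse_at_top_right by (simp add: divide_inverse)
  define T where "T R = (\<integral>v. indicator {v. R < \<bar>v\<bar>} v * G \<bar>v\<bar> \<partial>lborel)" for R
  \<comment> \<open>The three error terms: the deviation of \<open>g\<close> from \<open>c\<close>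
    within distance 1; beyond it, \<open>g\<close> against the bound G (1 / \<sigma>) for the
    kernel; and \<open>c\<close> against the tail of the kernel.\<close>
  have "((\<lambda>\<sigma>. (\<integral>x. G (\<bar>x - x0\<bar> / \<sigma>) \<partial>\<nu>) / \<sigma> + 1 / \<sigma> * G (1 / \<sigma>) * (\<integral>x. \<bar>g x\<bar> \<partial>lborel) + \<bar>c\<bar> * T (1 / \<sigma>))
      \<longlongrightarrow> 0 + 0 * (\<integral>x. \<bar>g x\<bar> \<partial>lborel) + \<bar>c\<bar> * 0) (at_right 0)"
    unfolding T_def
    by (intro tendsto_add tendsto_mult tendsto_const near filterlim_compose[OF mult_G_tendsto inv]
        filterlim_compose[OF tail_integral_tendsto inv])
  then have lim: "((\<lambda>\<sigma>. (\<integral>x. G (\<bar>x - x0\<bar> / \<sigma>) \<partial>\<nu>) / \<sigma> + 1 / \<sigma> * G (1 / \<sigma>) * (\<integral>x. \<bar>g x\<bar> \<partial>lborel) + \<bar>c\<bar> * T (1 / \<sigma>))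
      \<longlongrightarrow> 0) (at_right 0)"
    by simp
  have "((\<lambda>\<sigma>. (\<integral>x. k ((x - x0) / \<sigma>) * g x \<partial>lborel) / \<sigma> - c * (\<integral>v. k v \<partial>lborel)) \<longlongrightarrow> 0) (at_right 0)"
  proof (rule Lim_null_comparison[OF _ lim])
    show "\<forall>\<^sub>F \<sigma> in at_right 0. norm ((\<integral>x. k ((x - x0) / \<sigma>) * g x \<partial>lborel) / \<sigma> - c * (\<integral>v. k v \<partial>lborel))
      \<le> (\<integral>x. G (\<bar>x - x0\<bar> / \<sigma>) \<partial>\<nu>) / \<sigma> + 1 / \<sigma> * G (1 / \<sigma>) * (\<integral>x. \<bar>g x\<bar> \<partial>lborel) + \<bar>c\<bar> * T (1 / \<sigma>)"
      using eventually_at_right_less[of 0]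
    proof eventually_elim
      case (elim \<sigma>)
      let ?G = "\<lambda>x. G (\<bar>x - x0\<bar> / \<sigma>)" and ?k = "\<lambda>x. k ((x - x0) / \<sigma>)"
      have kG: "\<bar>?k x\<bar> \<le> ?G x" for x using k[of "(x - x0) / \<sigma>"] elim by (simp add: abs_divide)
      have G0: "?G x \<le> G 0" for x using elim by (intro antimonoD[OF antimono]) auto
      have iG: "integrable lborel ?G" by (rule scaled_integrable[OF elim])
      have ik: "integrable lborel ?k"
        by (rule Bochner_Integration.integrable_bound[OF iG]) (use kG nonneg in auto)
      have iGg: "integrable lborel (\<lambda>x. ?G x * h x)" if "integrable lborel h" for h :: "real \<Rightarrow> real"
      proof (rule Bochner_Integration.integrable_bound)
        show "integrable lborel (\<lambda>x. G 0 * h x)" using that by simp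
        have [measurable]: "h \<in> borel_measurable borel" using that by auto
        show "(\<lambda>x. ?G x * h x) \<in> borel_measurable lborel" by measurable
      qed (use G0 nonneg in \<open>auto simp: abs_mult intro!: mult_right_mono\<close>)
      have ikg: "integrable lborel (\<lambda>x. ?k x * g x)"
        by (rule Bochner_Integration.integrable_bound[OF iGg[OF g]])
          (use kG nonneg in \<open>auto simp: abs_mult intro!: mult_right_mono\<close>)
      have iT: "integrable lborel (\<lambda>x. indicator {x. 1 / \<sigma> < \<bar>x - x0\<bar> / \<sigma>} x * ?G x)"
        by (rule Bochner_Integration.integrable_bound[OF iG]) (auto split: split_indicator)
      have "(\<integral>x. ?k x * g x \<partial>lborel) - c * (\<sigma> * (\<integral>v. k v \<partial>lborel)) = (\<integral>x. ?k x * g x - c * ?k x \<partial>lborel)"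
        using ikg ik lborel_integral_scaled[OF elim, of k x0] by simp
      also have "norm \<dots> \<le> (\<integral>x. norm (?k x * g x - c * ?k x) \<partial>lborel)"
        by (rule integral_norm_bound)
      \<comment> \<open>Near \<open>x0\<close> use the Lebesgue point; far from it bound \<open>g\<close> and \<open>c\<close> separately.\<close>
      also have "\<dots> \<le> (\<integral>x. ?G x * w x + G (1 / \<sigma>) * \<bar>g x\<bar> +
          \<bar>c\<bar> * (indicator {x. 1 / \<sigma> < \<bar>x - x0\<bar> / \<sigma>} x * ?G x) \<partial>lborel)"
      proof (rule integral_mono)
        show "integrable lborel (\<lambda>x. norm (?k x * g x - c * ?k x))" using ik ikg by simp
        show "integrable lborel (\<lambda>x. ?G x * w x + G (1 / \<sigma>) * \<bar>g x\<bar> +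
            \<bar>c\<bar> * (indicator {x. 1 / \<sigma> < \<bar>x - x0\<bar> / \<sigma>} x * ?G x))"
          using iGg[OF iw] g iT by simp
        fix x
        have "?k x * g x - c * ?k x = ?k x * (g x - c)" by (simp add: algebra_simps)
        then have "norm (?k x * g x - c * ?k x) = \<bar>?k x\<bar> * \<bar>g x - c\<bar>" by (simp only: real_norm_def abs_mult)
        also have "\<dots> \<le> ?G x * \<bar>g x - c\<bar>" using kG by (intro mult_right_mono) auto
        finally have le: "norm (?k x * g x - c * ?k x) \<le> ?G x * \<bar>g x - c\<bar>" .
        show "norm (?k x * g x - c * ?k x) \<le> ?G x * w x + G (1 / \<sigma>) * \<bar>g x\<bar> +
            \<bar>c\<bar> * (indicator {x. 1 / \<sigma> < \<bar>x - x0\<bar> / \<sigma>} x * ?G x)"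
        proof (cases "x \<in> cball x0 1")
          case True
          have "0 \<le> G (1 / \<sigma>) * \<bar>g x\<bar>" "0 \<le> \<bar>c\<bar> * (indicator {x. 1 / \<sigma> < \<bar>x - x0\<bar> / \<sigma>} x * ?G x)"
            using nonneg by auto
          moreover have "?G x * \<bar>g x - c\<bar> = ?G x * w x" using True by (simp add: w_def)
          ultimately show ?thesis using le by linarith
        next
          case False
          then have far: "1 / \<sigma> < \<bar>x - x0\<bar> / \<sigma>"
            using elim by (intro divide_strict_right_mono) (auto simp: dist_real_def)
          have "?G x * \<bar>g x - c\<bar> \<le> ?G x * (\<bar>g x\<bar> + \<bar>c\<bar>)" using nonneg by (intro mult_left_mono) auto
          also have "\<dots> \<le> G (1 / \<sigma>) * \<bar>g x\<bar> + \<bar>c\<bar> * ?G x"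
            using mult_right_mono[OF antimonoD[OF antimono less_imp_le[OF far]], of "\<bar>g x\<bar>"]
            by (simp add: algebra_simps)
          finally have "?G x * \<bar>g x - c\<bar> \<le> G (1 / \<sigma>) * \<bar>g x\<bar> + \<bar>c\<bar> * ?G x" .
          moreover have "0 \<le> ?G x * w x" using w0 nonneg by simp
          ultimately show ?thesis using le far by simp
        qed
      qed
      also have "\<dots> = (\<integral>x. ?G x * w x \<partial>lborel) + G (1 / \<sigma>) * (\<integral>x. \<bar>g x\<bar> \<partial>lborel) +
          \<bar>c\<bar> * (\<integral>x. indicator {x. 1 / \<sigma> < \<bar>x - x0\<bar> / \<sigma>} x * ?G x \<partial>lborel)"
        using iGg[OF iw] g iT by simp
      also have "(\<integral>x. ?G x * w x \<partial>lborel) = (\<integral>x. ?G x \<partial>\<nu>)"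
        unfolding \<nu>_def using w0 by (subst integral_density) (auto simp: mult.commute)
      also have "(\<integral>x. indicator {x. 1 / \<sigma> < \<bar>x - x0\<bar> / \<sigma>} x * ?G x \<partial>lborel) = \<sigma> * T (1 / \<sigma>)"
        unfolding T_def using elim
        by (subst lborel_integral_scaled[OF elim, symmetric, of _ x0])
          (auto intro!: Bochner_Integration.integral_cong simp: abs_divide indicator_def)
      finally have *: "norm ((\<integral>x. ?k x * g x \<partial>lborel) - c * (\<sigma> * (\<integral>v. k v \<partial>lborel))) \<le>
          (\<integral>x. ?G x \<partial>\<nu>) + G (1 / \<sigma>) * (\<integral>x. \<bar>g x\<bar> \<partial>lborel) + \<bar>c\<bar> * (\<sigma> * T (1 / \<sigma>))" .
      have "norm ((\<integral>x. ?k x * g x \<partial>lborel) / \<sigma> - c * (\<integral>v. k v \<partial>lborel)) =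
          norm (((\<integral>x. ?k x * g x \<partial>lborel) - c * (\<sigma> * (\<integral>v. k v \<partial>lborel))) / \<sigma>)"
        using elim by (simp add: diff_divide_distrib)
      also have "\<dots> = norm ((\<integral>x. ?k x * g x \<partial>lborel) - c * (\<sigma> * (\<integral>v. k v \<partial>lborel))) / \<sigma>"
        using elim by simp
      also have "\<dots> \<le> ((\<integral>x. ?G x \<partial>\<nu>) + G (1 / \<sigma>) * (\<integral>x. \<bar>g x\<bar> \<partial>lborel) + \<bar>c\<bar> * (\<sigma> * T (1 / \<sigma>))) / \<sigma>"
        by (rule divide_right_mono[OF * less_imp_le[OF elim]])
      also have "\<dots> = (\<integral>x. ?G x \<partial>\<nu>) / \<sigma> + 1 / \<sigma> * G (1 / \<sigma>) * (\<integral>x. \<bar>g x\<bar> \<partial>lborel) + \<bar>c\<bar> * T (1 / \<sigma>)"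
        using elim by (simp add: add_divide_distrib)
      finally show ?case .
    qed
  qed
  then show ?thesis unfolding c_def by (rule LIM_zero_cancel)
qed

text \<open>A measure with derivative 0 at \<open>x0\<close> is invisible at scale \<sigma>, so only
  the density contributes to the limit.\<close>

lemma integral_mixture_tendsto:
  fixes g k :: "real \<Rightarrow> real" and \<nu> :: "real measure"
  assumes \<nu>: "finite_measure \<nu>" "sets \<nu> = sets borel"
      "((\<lambda>r. measure \<nu> (cball x0 r) / r) \<longlongrightarrow> 0) (at_right 0)"
    and g: "integrable lborel g"
      "((\<lambda>r. (\<integral>y\<in>cball x0 r. \<bar>g y - g x0\<bar> \<partial>lborel) / r) \<longlongrightarrow> 0) (at_right 0)"
    and k: "k \<in> borel_measurable borel" "\<And>v. \<bar>k v\<bar> \<le> G \<bar>v\<bar>"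
  shows "((\<lambda>\<sigma>. ((\<integral>x. k ((x - x0) / \<sigma>) \<partial>\<nu>) + (\<integral>x. k ((x - x0) / \<sigma>) * g x \<partial>lborel)) / \<sigma>)
    \<longlongrightarrow> g x0 * (\<integral>v. k v \<partial>lborel)) (at_right 0)"
proof -
  interpret finite_measure \<nu> by (rule \<nu>)
  note [measurable_cong] = \<nu>(2)
  note [measurable] = k(1)
  have "((\<lambda>\<sigma>. (\<integral>x. k ((x - x0) / \<sigma>) \<partial>\<nu>) / \<sigma>) \<longlongrightarrow> 0) (at_right 0)"
  proof (rule Lim_null_comparison[OF _ integral_zero_density_tendsto[OF \<nu>]])
    show "\<forall>\<^sub>F \<sigma> in at_right 0. norm ((\<integral>x. k ((x - x0) / \<sigma>) \<partial>\<nu>) / \<sigma>) \<le> (\<integral>x. G (\<bar>x - x0\<bar> / \<sigma>) \<partial>\<nu>) / \<sigma>"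
      using eventually_at_right_less[of 0]
    proof eventually_elim
      case (elim \<sigma>)
      have G0: "G (\<bar>x - x0\<bar> / \<sigma>) \<le> G 0" for x using elim by (intro antimonoD[OF antimono]) auto
      have iG: "integrable \<nu> (\<lambda>x. G (\<bar>x - x0\<bar> / \<sigma>))"
        using G0 nonneg by (intro integrable_const_bound[of _ "G 0"]) auto
      have kG: "\<bar>k ((x - x0) / \<sigma>)\<bar> \<le> G (\<bar>x - x0\<bar> / \<sigma>)" for x
        using k(2)[of "(x - x0) / \<sigma>"] elim by (simp add: abs_divide)
      have "norm (\<integral>x. k ((x - x0) / \<sigma>) \<partial>\<nu>) \<le> (\<integral>x. G (\<bar>x - x0\<bar> / \<sigma>) \<partial>\<nu>)"
      proof (rule Bochner_Integration.integral_norm_bound_integral[OF _ iG])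
        show "integrable \<nu> (\<lambda>x. k ((x - x0) / \<sigma>))"
          using order_trans[OF kG G0] by (intro integrable_const_bound[of _ "G 0"]) auto
      qed (use kG in auto)
      then show ?case using elim by (simp add: divide_right_mono)
    qed
  qed
  from tendsto_add[OF this integral_Lebesgue_point_tendsto[OF g k]]
  show ?thesis by (simp add: add_divide_distrib)
qed

end

section \<open>Doob densities\<close>

lemma integrable_indicator_bounded:
  fixes h :: "real \<Rightarrow> real"
  assumes [measurable]: "h \<in> borel_measurable borel" and C: "\<And>w. \<bar>h w\<bar> \<le> C"
    and A[measurable]: "A \<in> sets borel" and "bounded A"
  shows "integrable lborel (\<lambda>w. indicator A w * h w)"
proof (rule Bochner_Integration.integrable_bound)
  have "emeasure lborel A < \<infinity>" using \<open>bounded A\<close> by (rule emeasure_bounded_finite)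
  then show "integrable lborel (\<lambda>w. indicator A w * C)" using A by (intro integrable_mult_left) simp
  show "AE w in lborel. norm (indicator A w * h w) \<le> norm (indicator A w * C)"
    using C by (intro AE_I2) (auto split: split_indicator intro: order_trans[OF _ abs_ge_self])
qed simp

lemma bounded_abs_le: "bounded {w::real. \<bar>w\<bar> \<le> T}"
  by (auto simp: bounded_iff)

text \<open>The change of variable w -> s * w contributes a factor \<open>s\<close> and the decay a
  factor 1 / (2 s), so dilating an annulus outside radius \<open>R\<close> at least halves the
  integral over it.\<close>

lemma integrable_of_scaling_decay:
  fixes h :: "real \<Rightarrow> real"
  assumes [measurable]: "h \<in> borel_measurable borel"
    and nn: "\<And>w. 0 \<le> h w" and C: "\<And>w. h w \<le> C" and s: "1 < s" and R: "0 < R"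
    and decay: "\<And>w. R \<le> \<bar>w\<bar> \<Longrightarrow> h (s * w) \<le> h w / (2 * s)"
  shows "integrable lborel h"
proof -
  define A where "A a b = {w::real. a \<le> \<bar>w\<bar> \<and> \<bar>w\<bar> \<le> b}" for a b
  have [measurable]: "A a b \<in> sets borel" for a b unfolding A_def by measurable
  have "bounded (A a b)" for a b by (rule bounded_subset[OF bounded_abs_le[of b]]) (auto simp: A_def)
  then have iA: "integrable lborel (\<lambda>w. indicator (A a b) w * h w)" for a b
    using nn C by (intro integrable_indicator_bounded[where C = C]) auto
  define I where "I a b = (\<integral>w. indicator (A a b) w * h w \<partial>lborel)" for a b
  have half: "I (s * R) (s * T) \<le> I R T / 2" for T
  proof -
    have "I (s * R) (s * T) = \<bar>s\<bar> * (\<integral>w. indicator (A (s * R) (s * T)) (0 + s * w) * h (0 + s * w) \<partial>lborel)"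
      unfolding I_def using s lborel_integral_real_affine[of s "\<lambda>w. indicator (A (s * R) (s * T)) w * h w" 0] by simp
    also have "\<dots> \<le> s * (\<integral>w. indicator (A R T) w * h w / (2 * s) \<partial>lborel)"
    proof -
      have "(\<integral>w. indicator (A (s * R) (s * T)) (0 + s * w) * h (0 + s * w) \<partial>lborel) \<le>
         (\<integral>w. indicator (A R T) w * h w / (2 * s) \<partial>lborel)"
      proof (rule integral_mono_AE')
        show "AE w in lborel. indicator (A (s * R) (s * T)) (0 + s * w) * h (0 + s * w)
            \<le> indicator (A R T) w * h w / (2 * s)"
          using s decay by (intro AE_I2) (auto simp: A_def abs_mult split: split_indicator)
      qed (use iA nn s in auto)
      then show ?thesis using s unfolding abs_of_pos[OF less_trans[OF zero_less_one s]]
        by (intro mult_left_mono) auto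
    qed
    also have "\<dots> = I R T / 2" using s by (simp add: I_def)
    finally show ?thesis .
  qed
  \<comment> \<open>The outer piece is at most half of the left side. As truncated integrals are
    finite, it can be absorbed, which bounds them uniformly in \<open>T\<close>.\<close>
  have bound: "I R T \<le> 2 * I R (s * R)" if T: "R \<le> T" for T
  proof -
    have "I R T \<le> (\<integral>w. indicator (A R (s * R)) w * h w + indicator (A (s * R) (s * T)) w * h w \<partial>lborel)"
      unfolding I_def
    proof (rule integral_mono)
      fix w
      have "T \<le> s * T" using s T R by (simp add: mult_right_mono[of 1 s T, simplified])
      then show "indicator (A R T) w * h w \<le> indicator (A R (s * R)) w * h w + indicator (A (s * R) (s * T)) w * h w"
        using nn by (auto simp: A_def split: split_indicator)
    qed (intro iA Bochner_Integration.integrable_add)+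
    also have "\<dots> = I R (s * R) + I (s * R) (s * T)" using iA by (simp add: I_def)
    finally show ?thesis using half[of T] by linarith
  qed
  define S where "S n = (\<integral>w. indicator (A 0 (real n)) w * h w \<partial>lborel)" for n :: nat
  have "S n \<le> I 0 R + 2 * I R (s * R)" for n
  proof -
    have "S n \<le> (\<integral>w. indicator (A 0 R) w * h w + indicator (A R (max R n)) w * h w \<partial>lborel)"
      unfolding S_def
      by (intro integral_mono iA Bochner_Integration.integrable_add)
        (use nn in \<open>auto simp: A_def split: split_indicator\<close>)
    also have "\<dots> = I 0 R + I R (max R n)" using iA by (simp add: I_def)
    finally show ?thesis using bound[of "max R n"] by simp
  qed
  moreover have "incseq S"
    unfolding S_def by (intro incseq_SucI integral_mono iA) (use nn in \<open>auto simp: A_def split: split_indicator\<close>)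
  ultimately obtain L where L: "S \<longlonglongrightarrow> L"
    using incseq_convergent[of S] by metis
  show ?thesis
  proof (rule integrable_monotone_convergence[where f = "\<lambda>n w. indicator (A 0 (real n)) w * h w"])
    show "AE w in lborel. mono (\<lambda>n. indicator (A 0 (real n)) w * h w)"
      using nn by (intro AE_I2) (auto simp: mono_def A_def split: split_indicator)
    show "AE w in lborel. (\<lambda>n. indicator (A 0 (real n)) w * h w) \<longlonglongrightarrow> h w"
    proof (rule AE_I2)
      fix w
      obtain m :: nat where m: "\<bar>w\<bar> \<le> real m" using real_arch_simple by blast
      have "\<forall>\<^sub>F n in sequentially. indicator (A 0 (real n)) w * h w = h w"
        using eventually_ge_at_top[of m] by eventually_elim (use m in \<open>auto simp: A_def\<close>)
      then show "(\<lambda>n. indicator (A 0 (real n)) w * h w) \<longlonglongrightarrow> h w" by (rule tendsto_eventually)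
    qed
    show "(\<lambda>n. \<integral>w. indicator (A 0 (real n)) w * h w \<partial>lborel) \<longlonglongrightarrow> L" using L unfolding S_def[abs_def] .
  qed (use iA in auto)
qed

lemma doob_density_bounds:
  assumes "doob_density f"
  obtains B C where "\<And>u. f u \<le> B" "\<And>u. \<bar>u\<bar> * f u \<le> C"
proof -
  have "bounded (range f)" "bounded (range (\<lambda>u. \<bar>u\<bar> * f u))"
    using assms by (auto simp: doob_density_def)
  then obtain B C where BC: "\<forall>x\<in>range f. norm x \<le> B" "\<forall>x\<in>range (\<lambda>u. \<bar>u\<bar> * f u). norm x \<le> C"
    unfolding bounded_iff by metis
  show ?thesis
  proof
    show "f u \<le> B" for u using BC(1)[THEN bspec, of "f u"] by auto
    show "\<bar>u\<bar> * f u \<le> C" for u using BC(2)[THEN bspec, of "\<bar>u\<bar> * f u"] by auto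
  qed
qed

text \<open>
  Since \<open>\<bar>u\<bar> * f u\<close> is bounded, the lower bound (A2) forces \<open>\<delta> \<sigma> = O(\<sigma>)\<close>.
\<close>

lemma doob_density_rate:
  assumes f: "doob_density f"
  obtains \<delta> W where "0 < f z" "doob_rate \<delta>" "0 < W" "\<forall>\<^sub>F \<sigma> in at_right 0. \<delta> \<sigma> \<le> W * \<sigma>"
    "doob_tail (\<lambda>u. \<bar>u\<bar> * f u) \<delta> z"
proof -
  obtain B C where C: "\<And>u. \<bar>u\<bar> * f u \<le> C" by (rule doob_density_bounds[OF f]) blast
  have "\<exists>\<delta> \<delta>\<^sub>1. doob_rate \<delta> \<and> doob_rate \<delta>\<^sub>1 \<and>
        0 < Liminf (at_right 0) (\<lambda>\<sigma>. INF t\<in>{t. \<bar>t\<bar> \<le> \<delta> \<sigma>}. ereal (f (z - t / \<sigma>))) \<and>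
        doob_tail (\<lambda>u. \<bar>u\<bar> * f u) \<delta> z \<and> doob_tail f \<delta>\<^sub>1 z"
    using f unfolding doob_density_def by (elim conjE) (erule spec)
  then obtain \<delta> where \<delta>: "doob_rate \<delta>" "doob_tail (\<lambda>u. \<bar>u\<bar> * f u) \<delta> z"
    "0 < Liminf (at_right 0) (\<lambda>\<sigma>. INF t\<in>{t. \<bar>t\<bar> \<le> \<delta> \<sigma>}. ereal (f (z - t / \<sigma>)))"
    by (elim exE conjE)
  obtain y where y: "0 < ereal y"
    "ereal y < Liminf (at_right 0) (\<lambda>\<sigma>. INF t\<in>{t. \<bar>t\<bar> \<le> \<delta> \<sigma>}. ereal (f (z - t / \<sigma>)))"
    using ereal_dense2[OF \<delta>(3)] by (auto simp: zero_ereal_def)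
  have ev: "\<forall>\<^sub>F \<sigma> in at_right 0. ereal y < (INF t\<in>{t. \<bar>t\<bar> \<le> \<delta> \<sigma>}. ereal (f (z - t / \<sigma>)))"
    by (rule less_LiminfD[OF y(2)])
  have lower: "\<forall>\<^sub>F \<sigma> in at_right 0. \<forall>t. \<bar>t\<bar> \<le> \<delta> \<sigma> \<longrightarrow> y < f (z - t / \<sigma>)"
    using ev by eventually_elim (auto dest: less_INF_D)
  have pos: "\<forall>\<^sub>F \<sigma> in at_right 0. (0::real) < \<sigma> \<and> 0 < \<delta> \<sigma>"
    using eventually_at_right_less[of 0] by eventually_elim (use \<delta>(1) in \<open>auto simp: doob_rate_def\<close>)
  \<comment> \<open>The point t = 0 is admissible in (A2), and there the kernel equals
    \<open>f z\<close>.\<close>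
  have "\<forall>\<^sub>F \<sigma> in at_right (0::real). 0 < f z"
    using lower pos
  proof eventually_elim
    case (elim \<sigma>)
    then show ?case using y(1) by (auto dest!: spec[of _ 0])
  qed
  then have fz: "0 < f z" by simp
  \<comment> \<open>Evaluating (A2) at the extreme point t = \<delta> \<sigma> confines z - \<delta>
    \<sigma> / \<sigma> to a bounded set. The added 1 keeps the constant positive.\<close>
  have "\<forall>\<^sub>F \<sigma> in at_right 0. \<delta> \<sigma> \<le> (\<bar>z\<bar> + \<bar>C\<bar> / y + 1) * \<sigma>"
    using lower pos
  proof eventually_elim
    case (elim \<sigma>)
    then have "y < f (z - \<delta> \<sigma> / \<sigma>)" by auto
    then have "\<bar>z - \<delta> \<sigma> / \<sigma>\<bar> * y \<le> \<bar>z - \<delta> \<sigma> / \<sigma>\<bar> * f (z - \<delta> \<sigma> / \<sigma>)"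
      by (intro mult_left_mono) auto
    also have "\<dots> \<le> \<bar>C\<bar>" using C[of "z - \<delta> \<sigma> / \<sigma>"] by simp
    finally have "\<bar>z - \<delta> \<sigma> / \<sigma>\<bar> \<le> \<bar>C\<bar> / y" using y(1) by (simp add: pos_le_divide_eq)
    then have "\<delta> \<sigma> / \<sigma> \<le> \<bar>z\<bar> + \<bar>C\<bar> / y + 1" by linarith
    then show ?case using elim by (simp add: pos_divide_le_eq)
  qed
  moreover have "0 < \<bar>z\<bar> + \<bar>C\<bar> / y + 1" using y(1) by (intro add_nonneg_pos add_nonneg_nonneg) auto
  ultimately show ?thesis using that fz \<delta> by blast
qed

text \<open>At z = 0 the comparison in (A5) is a pure dilation. The result serves both the
  integrability of \<open>Z\<close> and that of the majorant.\<close>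

lemma doob_density_integrable:
  assumes f: "doob_density f" and [measurable]: "f \<in> borel_measurable borel"
  shows "integrable lborel (\<lambda>u. \<bar>u\<bar> * f u)"
proof -
  define h where "h u = \<bar>u\<bar> * f u" for u
  have f0: "0 \<le> f u" for u using f by (simp add: doob_density_def)
  obtain B C where C: "\<And>u. h u \<le> C" unfolding h_def by (rule doob_density_bounds[OF f]) blast
  obtain \<delta> W where \<delta>: "doob_rate \<delta>" "0 < W" "\<forall>\<^sub>F \<sigma> in at_right 0. \<delta> \<sigma> \<le> W * \<sigma>" "doob_tail h \<delta> 0"
    unfolding h_def by (rule doob_density_rate[OF f, of 0])
  \<comment> \<open>(A5) with \<open>o(\<delta> \<sigma>) = o(\<sigma>)\<close>: dilation by \<open>s = \<sigma>\<^sub>0 / \<sigma>\<close> lowers \<open>h\<close> by a factor \<open>2 s\<close> far out.\<close>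
  have "\<exists>\<^sub>F \<sigma>\<^sub>0 in at_right 0. \<exists>\<epsilon>. \<epsilon> \<in> o[at_right 0](\<delta>) \<and>
        (\<forall>\<^sub>F \<sigma> in at_right 0. \<forall>t. 1 \<le> \<bar>t\<bar> \<longrightarrow> h (0 - t / \<sigma>) \<le> \<epsilon> \<sigma> * h (0 - t / \<sigma>\<^sub>0))"
    using conjunct2[OF conjunct2[OF \<delta>(4)[unfolded doob_tail_def]]] zero_less_one by blast
  from frequently_ex[OF frequently_eventually_conj[OF this eventually_at_right_less[of 0]]]
  obtain \<sigma>\<^sub>0 \<epsilon> where \<sigma>0: "0 < \<sigma>\<^sub>0" and \<epsilon>: "\<epsilon> \<in> o[at_right 0](\<delta>)"
    "\<forall>\<^sub>F \<sigma> in at_right 0. \<forall>t. 1 \<le> \<bar>t\<bar> \<longrightarrow> h (0 - t / \<sigma>) \<le> \<epsilon> \<sigma> * h (0 - t / \<sigma>\<^sub>0)"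
    by blast
  \<comment> \<open>Chosen so that \<eta> * W * \<sigma> is half of \<sigma> / \<sigma>0, the factor
    demanded by the dilation s = \<sigma>0 / \<sigma>, where \<sigma>0 stands for
    \<open>\<sigma>\<^sub>0\<close>.\<close>
  define \<eta> where "\<eta> = 1 / (2 * W * \<sigma>\<^sub>0)"
  have \<eta>: "0 < \<eta>" using \<delta> \<sigma>0 by (simp add: \<eta>_def)
  have "\<forall>\<^sub>F \<sigma> in at_right 0. norm (\<epsilon> \<sigma>) \<le> \<eta> * norm (\<delta> \<sigma>)"
    by (rule landau_o.smallD[OF \<epsilon>(1) \<eta>])
  moreover have "\<forall>\<^sub>F \<sigma> in at_right 0. 0 < \<sigma> \<and> \<sigma> < \<sigma>\<^sub>0"
    using \<sigma>0 by (auto simp: eventually_at_right_field)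
  ultimately have "\<forall>\<^sub>F \<sigma> in at_right 0. 0 < \<sigma> \<and> \<sigma> < \<sigma>\<^sub>0 \<and> norm (\<epsilon> \<sigma>) \<le> \<eta> * norm (\<delta> \<sigma>) \<and> \<delta> \<sigma> \<le> W * \<sigma> \<and>
      (\<forall>t. 1 \<le> \<bar>t\<bar> \<longrightarrow> h (0 - t / \<sigma>) \<le> \<epsilon> \<sigma> * h (0 - t / \<sigma>\<^sub>0))"
    using \<delta>(3) \<epsilon>(2) by eventually_elim simp
  from eventually_happens[OF this] obtain \<sigma> where \<sigma>: "0 < \<sigma>" "\<sigma> < \<sigma>\<^sub>0" "\<bar>\<epsilon> \<sigma>\<bar> \<le> \<eta> * \<bar>\<delta> \<sigma>\<bar>" "\<delta> \<sigma> \<le> W * \<sigma>"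
      "\<And>t. 1 \<le> \<bar>t\<bar> \<Longrightarrow> h (0 - t / \<sigma>) \<le> \<epsilon> \<sigma> * h (0 - t / \<sigma>\<^sub>0)"
    unfolding real_norm_def using trivial_limit_at_right_real by blast
  have "\<epsilon> \<sigma> \<le> \<eta> * (W * \<sigma>)"
  proof -
    have "0 < \<delta> \<sigma>" using \<delta>(1) \<sigma>(1) by (simp add: doob_rate_def)
    then have "\<epsilon> \<sigma> \<le> \<eta> * \<delta> \<sigma>" using abs_ge_self[of "\<epsilon> \<sigma>"] \<sigma>(3) by simp
    also have "\<dots> \<le> \<eta> * (W * \<sigma>)" using \<sigma> \<eta> by (intro mult_left_mono) auto
    finally show ?thesis .
  qed
  also have "\<dots> = 1 / (2 * (\<sigma>\<^sub>0 / \<sigma>))" using \<delta>(2) \<sigma>0 by (simp add: \<eta>_def field_simps)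
  finally have \<epsilon>\<sigma>: "\<epsilon> \<sigma> \<le> 1 / (2 * (\<sigma>\<^sub>0 / \<sigma>))" .
  have "integrable lborel h"
  \<comment> \<open>With w = - t / \<sigma>0 the range |t| >= 1 becomes |w| >= 1 / \<sigma>0, whence
    the value of \<open>R\<close>; again \<sigma>0 stands for
    \<open>\<sigma>\<^sub>0\<close>.\<close>
  proof (rule integrable_of_scaling_decay[where s = "\<sigma>\<^sub>0 / \<sigma>" and R = "1 / \<sigma>\<^sub>0" and C = C])
    fix w assume w: "1 / \<sigma>\<^sub>0 \<le> \<bar>w\<bar>"
    then have "1 \<le> \<bar>- w * \<sigma>\<^sub>0\<bar>" using \<sigma>0 by (simp add: abs_mult pos_divide_le_eq)
    from \<sigma>(5)[OF this] have "h (\<sigma>\<^sub>0 / \<sigma> * w) \<le> \<epsilon> \<sigma> * h w"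
      using \<sigma>0 by (simp add: mult.commute)
    also have "\<dots> \<le> 1 / (2 * (\<sigma>\<^sub>0 / \<sigma>)) * h w"
      using \<epsilon>\<sigma> f0 by (intro mult_right_mono) (auto simp: h_def)
    finally show "h (\<sigma>\<^sub>0 / \<sigma> * w) \<le> h w / (2 * (\<sigma>\<^sub>0 / \<sigma>))" by (simp add: mult.commute)
  next
    show "h \<in> borel_measurable borel" unfolding h_def by measurable
    show "1 < \<sigma>\<^sub>0 / \<sigma>" using \<sigma>(1,2) by simp
    show "0 < 1 / \<sigma>\<^sub>0" using \<sigma>0 by simp
    show "0 \<le> h w" "h w \<le> C" for w using C f0 by (auto simp: h_def)
  qed
  then show ?thesis unfolding h_def[abs_def] .
qed

lemma tail_sup_scale:
  assumes "0 < \<sigma>"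
  shows "tail_sup h z \<sigma> (\<sigma> * r) = tail_sup h z 1 r"
proof -
  have "(\<lambda>t. h (z - t / \<sigma>)) ` {t. \<sigma> * r \<le> \<bar>t\<bar>} = (\<lambda>t. h (z - t / 1)) ` {t. r \<le> \<bar>t\<bar>}"
  proof (intro equalityI subsetI)
    fix y assume "y \<in> (\<lambda>t. h (z - t / \<sigma>)) ` {t. \<sigma> * r \<le> \<bar>t\<bar>}"
    then obtain t where "\<sigma> * r \<le> \<bar>t\<bar>" "y = h (z - t / \<sigma>)" by auto
    then show "y \<in> (\<lambda>t. h (z - t / 1)) ` {t. r \<le> \<bar>t\<bar>}"
      using assms by (intro image_eqI[of _ _ "t / \<sigma>"]) (auto simp: pos_le_divide_eq mult.commute)
  next
    fix y assume "y \<in> (\<lambda>t. h (z - t / 1)) ` {t. r \<le> \<bar>t\<bar>}"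
    then obtain t where "r \<le> \<bar>t\<bar>" "y = h (z - t)" by auto
    then show "y \<in> (\<lambda>t. h (z - t / \<sigma>)) ` {t. \<sigma> * r \<le> \<bar>t\<bar>}"
      using assms by (intro image_eqI[of _ _ "\<sigma> * t"]) (auto simp: abs_mult)
  qed
  then show ?thesis unfolding tail_sup_def by simp
qed

text \<open>The tail supremum \<open>H\<close> is the least decreasing majorant of |z - v| * f (z -
  v) in |v|. It is integrable because it is bounded by a constant up to \<open>W\<close> and by a
  multiple of the integrable function itself beyond \<open>W\<close>.\<close>

lemma doob_density_majorant:
  assumes f: "doob_density f" and [measurable]: "f \<in> borel_measurable borel"
  obtains G where "radial_majorant G" "\<And>v. f (z - v) \<le> G \<bar>v\<bar>" "\<And>v. \<bar>z - v\<bar> * f (z - v) \<le> G \<bar>v\<bar>"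
proof -
  define h where "h u = \<bar>u\<bar> * f u" for u
  have f0: "0 \<le> f u" for u using f by (simp add: doob_density_def)
  then have h0: "0 \<le> h u" for u by (simp add: h_def)
  obtain B C where B: "\<And>u. f u \<le> B" and C: "\<And>u. h u \<le> C"
    unfolding h_def by (rule doob_density_bounds[OF f]) blast
  have B0: "0 \<le> B" using f0 B order_trans by blast
  obtain \<delta> W where \<delta>: "doob_rate \<delta>" "0 < W" "\<forall>\<^sub>F \<sigma> in at_right 0. \<delta> \<sigma> \<le> W * \<sigma>" "doob_tail h \<delta> z"
    unfolding h_def by (rule doob_density_rate[OF f, of z])
  define H where "H = tail_sup h z 1"
  have ne: "{t. r \<le> \<bar>t\<bar>} \<noteq> {}" for r :: real by (auto intro!: exI[of _ r])
  have bdd: "bdd_above ((\<lambda>t. h (z - t / 1)) ` {t. r \<le> \<bar>t\<bar>})" for r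
    using C by (auto intro!: bdd_aboveI[of _ C])
  have hH: "h (z - v) \<le> H r" if "r \<le> \<bar>v\<bar>" for v r
    using that cSUP_upper[OF _ bdd, of v r] by (simp add: H_def tail_sup_def)
  have HC: "H r \<le> C" for r
    unfolding H_def tail_sup_def using C by (intro cSUP_least ne) auto
  have H0: "0 \<le> H r" for r using hH[of r r] h0 order_trans by (metis abs_ge_self)
  have Hmono: "antimono H"
    unfolding H_def tail_sup_def by (intro antimonoI cSUP_subset_mono ne bdd) auto
  \<comment> \<open>As \<open>\<delta> \<sigma> \<le> W * \<sigma>\<close>, substituting \<open>t = \<sigma> * v\<close> in (A4) covers all \<open>v\<close> with \<open>\<bar>v\<bar> \<ge> W\<close>.\<close>
  obtain b where "\<forall>\<^sub>F \<gamma> in at_right 0. \<forall>\<^sub>F \<sigma> in at_right 0.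
        \<forall>t. \<bar>t\<bar> \<in> {\<delta> \<sigma>..\<gamma>} \<longrightarrow> tail_sup h z \<sigma> \<bar>t\<bar> \<le> b * h (z - t / \<sigma>)"
    using \<delta>(4) unfolding doob_tail_def by blast
  from eventually_happens[OF eventually_conj[OF this eventually_at_right_less[of 0]]]
  obtain \<gamma> where \<gamma>: "0 < \<gamma>" "\<forall>\<^sub>F \<sigma> in at_right 0.
        \<forall>t. \<bar>t\<bar> \<in> {\<delta> \<sigma>..\<gamma>} \<longrightarrow> tail_sup h z \<sigma> \<bar>t\<bar> \<le> b * h (z - t / \<sigma>)"
    by auto
  have far: "H \<bar>v\<bar> \<le> \<bar>b\<bar> * h (z - v)" if v: "W \<le> \<bar>v\<bar>" for v
  proof -
    have v0: "0 < \<bar>v\<bar>" using v \<delta>(2) by linarith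
    \<comment> \<open>This range of \<sigma> keeps \<sigma> * |v| below \<gamma>, the upper end of
      the range of (A4).\<close>
    have "\<forall>\<^sub>F \<sigma> in at_right 0. 0 < \<sigma> \<and> \<sigma> < \<gamma> / \<bar>v\<bar>"
      using v0 \<gamma>(1) unfolding eventually_at_right_field by (intro exI[of _ "\<gamma> / \<bar>v\<bar>"]) simp
    then have "\<forall>\<^sub>F \<sigma> in at_right 0. 0 < \<sigma> \<and> \<sigma> < \<gamma> / \<bar>v\<bar> \<and> \<delta> \<sigma> \<le> W * \<sigma> \<and>
        (\<forall>t. \<bar>t\<bar> \<in> {\<delta> \<sigma>..\<gamma>} \<longrightarrow> tail_sup h z \<sigma> \<bar>t\<bar> \<le> b * h (z - t / \<sigma>))"
      using \<gamma>(2) \<delta>(3) by eventually_elim blast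
    from eventually_happens[OF this] obtain \<sigma> where \<sigma>: "0 < \<sigma>" "\<sigma> < \<gamma> / \<bar>v\<bar>" "\<delta> \<sigma> \<le> W * \<sigma>"
        "\<And>t. \<bar>t\<bar> \<in> {\<delta> \<sigma>..\<gamma>} \<Longrightarrow> tail_sup h z \<sigma> \<bar>t\<bar> \<le> b * h (z - t / \<sigma>)"
      by auto
    have "\<delta> \<sigma> \<le> \<bar>v\<bar> * \<sigma>" using \<sigma>(3) mult_right_mono[OF v, of \<sigma>] \<sigma>(1) by linarith
    then have "\<bar>\<sigma> * v\<bar> \<in> {\<delta> \<sigma>..\<gamma>}" using \<sigma> v0 by (auto simp: abs_mult pos_less_divide_eq mult.commute)
    from \<sigma>(4)[OF this] have "tail_sup h z \<sigma> (\<sigma> * \<bar>v\<bar>) \<le> b * h (z - v)" using \<sigma> by (simp add: abs_mult)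
    also have "\<dots> \<le> \<bar>b\<bar> * h (z - v)" using h0 by (intro mult_right_mono) auto
    finally show ?thesis by (simp add: H_def tail_sup_scale[OF \<sigma>(1)])
  qed
  have "(\<lambda>r. - (- H r)) \<in> borel_measurable borel"
    using Hmono by (intro borel_measurable_uminus borel_measurable_mono) (auto simp: mono_def antimono_def)
  then have [measurable]: "H \<in> borel_measurable borel" by simp
  have "integrable lborel (\<lambda>v. h (z - v))"
    using lborel_integrable_real_affine[OF doob_density_integrable[OF f], of "-1" z]
    by (simp add: h_def)
  then have "integrable lborel (\<lambda>v. indicator {v. \<bar>v\<bar> \<le> W} v * C + \<bar>b\<bar> * h (z - v))"
    using \<delta>(2) by (intro Bochner_Integration.integrable_add integrable_mult_right
        integrable_indicator_bounded[where C = "\<bar>C\<bar>"] bounded_abs_le) auto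
  then have iH: "integrable lborel (\<lambda>v. H \<bar>v\<bar>)"
  proof (rule Bochner_Integration.integrable_bound)
    show "AE v in lborel. norm (H \<bar>v\<bar>) \<le> norm (indicator {v. \<bar>v\<bar> \<le> W} v * C + \<bar>b\<bar> * h (z - v))"
    proof (rule AE_I2)
      fix v
      have "H \<bar>v\<bar> \<le> indicator {v. \<bar>v\<bar> \<le> W} v * C + \<bar>b\<bar> * h (z - v)"
        using far[of v] HC[of "\<bar>v\<bar>"] h0[of "z - v"] by (cases "\<bar>v\<bar> \<le> W") (auto intro: add_increasing2)
      then show "norm (H \<bar>v\<bar>) \<le> norm (indicator {v. \<bar>v\<bar> \<le> W} v * C + \<bar>b\<bar> * h (z - v))"
        using H0[of "\<bar>v\<bar>"] by simp
    qed
  qed measurable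
  \<comment> \<open>For |v| > |z| + 1 the factor |z - v| exceeds 1, so \<open>H\<close> dominates
    \<open>f\<close> too; the indicator term takes care of the remaining \<open>v\<close>.\<close>
  define G where "G r = H r + indicator {..\<bar>z\<bar> + 1} r * B" for r
  have "radial_majorant G"
  proof
    show "antimono G"
      unfolding G_def using antimonoD[OF Hmono] B0
      by (intro antimonoI add_mono) (auto split: split_indicator)
    show "0 \<le> G r" for r using H0 B0 by (simp add: G_def)
    have "integrable lborel (\<lambda>v. indicator {v. \<bar>v\<bar> \<le> \<bar>z\<bar> + 1} v * B)"
      using B0 by (intro integrable_indicator_bounded[where C = B] bounded_abs_le) auto
    then have "integrable lborel (\<lambda>v. H \<bar>v\<bar> + indicator {v. \<bar>v\<bar> \<le> \<bar>z\<bar> + 1} v * B)"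
      by (rule Bochner_Integration.integrable_add[OF iH])
    then show "integrable lborel (\<lambda>v. G \<bar>v\<bar>)"
      by (simp add: G_def indicator_def)
  qed
  moreover have "\<bar>z - v\<bar> * f (z - v) \<le> G \<bar>v\<bar>" for v
    using hH[of "\<bar>v\<bar>" v] B0 by (simp add: G_def h_def add_increasing2)
  moreover have "f (z - v) \<le> G \<bar>v\<bar>" for v
  proof (cases "\<bar>v\<bar> \<le> \<bar>z\<bar> + 1")
    case True
    then show ?thesis using B H0 by (simp add: G_def add_increasing)
  next
    case False
    then have "1 * f (z - v) \<le> \<bar>z - v\<bar> * f (z - v)" using f0 by (intro mult_right_mono) auto
    then show ?thesis using False hH[of "\<bar>v\<bar>" v] by (simp add: G_def h_def)
  qed
  ultimately show ?thesis using that by blast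
qed

section \<open>Limits of the conditional noise\<close>

lemma cond_noise_shift:
  assumes "0 < \<sigma>"
  shows "cond_noise M X f \<sigma> (x0 + \<sigma> * z) =
    (\<integral>\<omega>. (z - (X \<omega> - x0) / \<sigma>) * f (z - (X \<omega> - x0) / \<sigma>) \<partial>M) / (\<integral>\<omega>. f (z - (X \<omega> - x0) / \<sigma>) \<partial>M)"
proof -
  have "(x0 + \<sigma> * z - X \<omega>) / \<sigma> = z - (X \<omega> - x0) / \<sigma>" for \<omega>
    using assms by (simp add: field_simps)
  then show ?thesis by (simp add: cond_noise_def)
qed

lemma cond_noise_tendsto_atom:
  assumes "prob_space M" and X: "X \<in> borel_measurable M"
    and f: "doob_density f" and [measurable]: "f \<in> borel_measurable borel"
    and atom: "measure M {\<omega> \<in> space M. X \<omega> = x0} \<noteq> 0"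
  shows "((\<lambda>\<sigma>. cond_noise M X f \<sigma> (x0 + \<sigma> * z)) \<longlongrightarrow> z) (at_right 0)"
proof -
  interpret prob_space M by (rule assms)
  obtain G where "radial_majorant G" and G: "\<And>v. f (z - v) \<le> G \<bar>v\<bar>" "\<And>v. \<bar>z - v\<bar> * f (z - v) \<le> G \<bar>v\<bar>"
    by (rule doob_density_majorant[OF f, of z]) auto
  interpret radial_majorant G by fact
  have f0: "0 \<le> f u" for u using f by (simp add: doob_density_def)
  \<comment> \<open>Positivity at every \<open>z\<close>, a consequence of (A2), keeps the limit of
    the denominator away from 0.\<close>
  have fz: "0 < f z" by (rule doob_density_rate[OF f])
  let ?p = "measure M {\<omega> \<in> space M. X \<omega> = x0}"
  have "((\<lambda>\<sigma>. \<integral>\<omega>. (\<lambda>v. (z - v) * f (z - v)) ((X \<omega> - x0) / \<sigma>) \<partial>M)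
      \<longlongrightarrow> (\<lambda>v. (z - v) * f (z - v)) 0 * ?p) (at_right 0)"
    by (rule integral_atom_tendsto[OF finite_measure_axioms X])
      (use G f0 in \<open>auto simp: abs_mult\<close>)
  moreover have "((\<lambda>\<sigma>. \<integral>\<omega>. (\<lambda>v. f (z - v)) ((X \<omega> - x0) / \<sigma>) \<partial>M)
      \<longlongrightarrow> (\<lambda>v. f (z - v)) 0 * ?p) (at_right 0)"
    by (rule integral_atom_tendsto[OF finite_measure_axioms X]) (use G f0 in auto)
  ultimately have "((\<lambda>\<sigma>. (\<integral>\<omega>. (z - (X \<omega> - x0) / \<sigma>) * f (z - (X \<omega> - x0) / \<sigma>) \<partial>M) /
      (\<integral>\<omega>. f (z - (X \<omega> - x0) / \<sigma>) \<partial>M)) \<longlongrightarrow> (z * f z * ?p) / (f z * ?p)) (at_right 0)"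
    using fz atom by (intro tendsto_divide) auto
  then have "((\<lambda>\<sigma>. (\<integral>\<omega>. (z - (X \<omega> - x0) / \<sigma>) * f (z - (X \<omega> - x0) / \<sigma>) \<partial>M) /
      (\<integral>\<omega>. f (z - (X \<omega> - x0) / \<sigma>) \<partial>M)) \<longlongrightarrow> z) (at_right 0)"
    using fz atom by simp
  moreover have "\<forall>\<^sub>F \<sigma> in at_right 0. (\<integral>\<omega>. (z - (X \<omega> - x0) / \<sigma>) * f (z - (X \<omega> - x0) / \<sigma>) \<partial>M) /
      (\<integral>\<omega>. f (z - (X \<omega> - x0) / \<sigma>) \<partial>M) = cond_noise M X f \<sigma> (x0 + \<sigma> * z)"
    using eventually_at_right_less[of 0] by eventually_elim (simp add: cond_noise_shift)
  ultimately show ?thesis by (rule Lim_transform_eventually)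
qed

text \<open>\<open>law\<close> states the decomposition of the distribution of \<open>X\<close>
  through integrals of bounded functions, the form in which the kernels are inserted.\<close>

lemma cond_noise_tendsto_density:
  fixes \<nu> :: "real measure" and g :: "real \<Rightarrow> real"
  assumes \<nu>: "finite_measure \<nu>" "sets \<nu> = sets borel"
      "((\<lambda>r. measure \<nu> (cball x0 r) / r) \<longlongrightarrow> 0) (at_right 0)"
    and g: "integrable lborel g"
      "((\<lambda>r. (\<integral>y\<in>cball x0 r. \<bar>g y - g x0\<bar> \<partial>lborel) / r) \<longlongrightarrow> 0) (at_right 0)"
    and g0: "g x0 \<noteq> 0"
    and law: "\<And>\<phi> B. \<phi> \<in> borel_measurable borel \<Longrightarrow> (\<And>x. \<bar>\<phi> x\<bar> \<le> B) \<Longrightarrow>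
      (\<integral>\<omega>. \<phi> (X \<omega>) \<partial>M) = (\<integral>x. \<phi> x \<partial>\<nu>) + (\<integral>x. \<phi> x * g x \<partial>lborel)"
    and f: "doob_density f" and [measurable]: "f \<in> borel_measurable borel"
    and f1: "(\<integral>u. f u \<partial>lborel) = 1"
  shows "((\<lambda>\<sigma>. cond_noise M X f \<sigma> (x0 + \<sigma> * z)) \<longlongrightarrow> (\<integral>u. u * f u \<partial>lborel)) (at_right 0)"
proof -
  obtain G where "radial_majorant G" and G: "\<And>v. f (z - v) \<le> G \<bar>v\<bar>" "\<And>v. \<bar>z - v\<bar> * f (z - v) \<le> G \<bar>v\<bar>"
    by (rule doob_density_majorant[OF f, of z]) auto
  interpret radial_majorant G by fact
  have f0: "0 \<le> f u" for u using f by (simp add: doob_density_def)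
  have lim: "((\<lambda>\<sigma>. (\<integral>\<omega>. k ((X \<omega> - x0) / \<sigma>) \<partial>M) / \<sigma>) \<longlongrightarrow> g x0 * (\<integral>v. k v \<partial>lborel)) (at_right 0)"
    if k[measurable]: "k \<in> borel_measurable borel" "\<And>v. \<bar>k v\<bar> \<le> G \<bar>v\<bar>" for k
  proof -
    have "(\<integral>\<omega>. k ((X \<omega> - x0) / \<sigma>) \<partial>M) =
        (\<integral>x. k ((x - x0) / \<sigma>) \<partial>\<nu>) + (\<integral>x. k ((x - x0) / \<sigma>) * g x \<partial>lborel)" for \<sigma>
      by (rule law[of "\<lambda>x. k ((x - x0) / \<sigma>)" "G 0"]) (auto intro: abs_le_G0[OF k(2)])
    then show ?thesis using integral_mixture_tendsto[OF \<nu> g k] by simp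
  qed
  let ?N = "\<lambda>\<sigma>. \<integral>\<omega>. (z - (X \<omega> - x0) / \<sigma>) * f (z - (X \<omega> - x0) / \<sigma>) \<partial>M"
  let ?D = "\<lambda>\<sigma>. \<integral>\<omega>. f (z - (X \<omega> - x0) / \<sigma>) \<partial>M"
  have "((\<lambda>\<sigma>. ?N \<sigma> / \<sigma>) \<longlongrightarrow> g x0 * (\<integral>v. (z - v) * f (z - v) \<partial>lborel)) (at_right 0)"
    by (rule lim[of "\<lambda>v. (z - v) * f (z - v)"]) (use G f0 in \<open>auto simp: abs_mult\<close>)
  moreover have "((\<lambda>\<sigma>. ?D \<sigma> / \<sigma>) \<longlongrightarrow> g x0 * (\<integral>v. f (z - v) \<partial>lborel)) (at_right 0)"
    by (rule lim[of "\<lambda>v. f (z - v)"]) (use G f0 in auto)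
  \<comment> \<open>The reflection v -> z - v turns the limits into moments of \<open>f\<close>;
    this is why \<open>z\<close> disappears from the result.\<close>
  ultimately have "((\<lambda>\<sigma>. (?N \<sigma> / \<sigma>) / (?D \<sigma> / \<sigma>)) \<longlongrightarrow>
      (g x0 * (\<integral>u. u * f u \<partial>lborel)) / (g x0 * 1)) (at_right 0)"
    using g0 f1 lborel_integral_reflect[of f z] lborel_integral_reflect[of "\<lambda>u. u * f u" z]
    by (intro tendsto_divide) auto
  then have "((\<lambda>\<sigma>. (?N \<sigma> / \<sigma>) / (?D \<sigma> / \<sigma>)) \<longlongrightarrow> (\<integral>u. u * f u \<partial>lborel)) (at_right 0)"
    using g0 by simp
  moreover have "\<forall>\<^sub>F \<sigma> in at_right 0. (?N \<sigma> / \<sigma>) / (?D \<sigma> / \<sigma>) = cond_noise M X f \<sigma> (x0 + \<sigma> * z)"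
    using eventually_at_right_less[of 0] by eventually_elim (simp add: cond_noise_shift)
  ultimately show ?thesis by (rule Lim_transform_eventually)
qed

text \<open>Stated for an event \<open>A\<close> on which the law of \<open>X\<close> is absolutely
  continuous and off which \<open>X\<close> is discrete, so that it covers the mixture
  (\<open>A\<close> the event U = 2) and \<open>X\<^sub>2\<close> alone (\<open>A\<close> the whole
  space).\<close>

lemma AE_cond_noise_tendsto:
  fixes X :: "'a \<Rightarrow> real"
  assumes "prob_space M" and X[measurable]: "X \<in> borel_measurable M" and A[measurable]: "A \<in> sets M"
    and S: "countable S" "AE \<omega> in M. \<omega> \<notin> A \<longrightarrow> X \<omega> \<in> S"
    and ac: "\<And>N. N \<in> null_sets lborel \<Longrightarrow> AE \<omega> in M. \<omega> \<in> A \<longrightarrow> X \<omega> \<notin> N"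
    and f: "doob_density f" and fm[measurable]: "f \<in> borel_measurable borel"
    and f1: "(\<integral>u. f u \<partial>lborel) = 1"
  shows "AE \<omega> in M. \<forall>z. ((\<lambda>\<sigma>. cond_noise M X f \<sigma> (X \<omega> + \<sigma> * z)) \<longlongrightarrow>
    (if \<omega> \<in> A then (\<integral>u. u * f u \<partial>lborel) else z)) (at_right 0)"
proof -
  interpret prob_space M by (rule assms)
  \<comment> \<open>\<open>\<nu> B\<close> is the law of \<open>X\<close> restricted to the event
    \<open>B\<close>, without normalisation, so the parts over \<open>A\<close> and its complement
    add up to the law of \<open>X\<close>.\<close>
  define \<nu> where "\<nu> B = distr (density M (\<lambda>\<omega>. ennreal (indicator B \<omega>))) borel X" for B
  have sets_\<nu>[measurable_cong]: "sets (\<nu> B) = sets borel" for B by (simp add: \<nu>_def)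
  have em: "emeasure (\<nu> B) N = emeasure M (B \<inter> (X -` N \<inter> space M))"
    if [measurable]: "N \<in> sets borel" "B \<in> sets M" for B N
  proof -
    have "emeasure (\<nu> B) N = (\<integral>\<^sup>+\<omega>. ennreal (indicator B \<omega>) * indicator (X -` N \<inter> space M) \<omega> \<partial>M)"
      unfolding \<nu>_def by (subst emeasure_distr, simp, simp, subst emeasure_density) auto
    also have "\<dots> = (\<integral>\<^sup>+\<omega>. indicator (B \<inter> (X -` N \<inter> space M)) \<omega> \<partial>M)"
      by (intro nn_integral_cong) (auto split: split_indicator)
    finally show ?thesis by simp
  qed
  have fin: "finite_measure (\<nu> B)" if "B \<in> sets M" for B
    using em[of UNIV B] that sets_eq_imp_space_eq[OF sets_\<nu>[of B]] by (intro finite_measureI) simp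
  have int: "(\<integral>x. \<phi> x \<partial>\<nu> B) = (\<integral>\<omega>. indicator B \<omega> * \<phi> (X \<omega>) \<partial>M)"
    if [measurable]: "B \<in> sets M" "\<phi> \<in> borel_measurable borel" for B and \<phi> :: "real \<Rightarrow> real"
    unfolding \<nu>_def by (subst integral_distr, simp, simp, subst integral_density) auto
  have ac\<nu>: "absolutely_continuous lborel (\<nu> A)"
    unfolding absolutely_continuous_def
  proof
    fix N :: "real set" assume N: "N \<in> null_sets lborel"
    then have [measurable]: "N \<in> sets borel" by auto
    have "A \<inter> (X -` N \<inter> space M) \<in> null_sets M"
      using ac[OF N] by (subst AE_iff_null_sets) (auto elim!: eventually_mono)
    then show "N \<in> null_sets (\<nu> A)" by (auto simp: null_sets_def em sets_\<nu>)
  qed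
  obtain g where g: "g \<in> borel_measurable lborel" "AE x in lborel. RN_deriv lborel (\<nu> A) x = ennreal (g x)"
      "\<And>x. 0 \<le> g x"
    by (rule sigma_finite_measure.real_RN_deriv[OF lborel.sigma_finite_measure_axioms fin[OF A] ac\<nu>])
      (simp_all add: sets_\<nu>)
  have [measurable]: "g \<in> borel_measurable borel" using g(1) by simp
  have \<nu>A: "\<nu> A = density lborel (\<lambda>x. ennreal (g x))"
    using sigma_finite_measure.density_RN_deriv[OF lborel.sigma_finite_measure_axioms ac\<nu>] sets_\<nu> g by (subst density_cong[symmetric, OF _ _ g(2)]) auto
  have ig: "integrable lborel g"
  proof (rule integrableI_nonneg)
    have "(\<integral>\<^sup>+x. ennreal (g x) \<partial>lborel) = emeasure (\<nu> A) UNIV"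
      unfolding \<nu>A by (subst emeasure_density) auto
    also have "\<dots> < \<infinity>" using em[of UNIV A] by (simp add: less_top[symmetric])
    finally show "(\<integral>\<^sup>+x. ennreal (g x) \<partial>lborel) < \<infinity>" .
  qed (use g in auto)
  let ?\<nu>' = "\<nu> (space M - A)"
  have [measurable]: "S \<in> sets borel" using S(1) by (rule sets.countable[rotated]) auto
  have S0: "emeasure ?\<nu>' (- S) = 0"
  proof -
    have "(space M - A) \<inter> (X -` (- S) \<inter> space M) \<in> null_sets M"
      using S(2) by (subst AE_iff_null_sets) (auto elim!: eventually_mono)
    then show ?thesis by (subst em) auto
  qed
  have law: "(\<integral>\<omega>. \<phi> (X \<omega>) \<partial>M) = (\<integral>x. \<phi> x \<partial>?\<nu>') + (\<integral>x. \<phi> x * g x \<partial>lborel)"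
    if [measurable]: "\<phi> \<in> borel_measurable borel" and B: "\<And>x. \<bar>\<phi> x\<bar> \<le> B" for \<phi> B
  proof -
    have i: "integrable M (\<lambda>\<omega>. indicator C \<omega> * \<phi> (X \<omega>))" if [measurable]: "C \<in> sets M" for C
      using B order_trans[OF abs_ge_zero B] by (intro integrable_const_bound[of _ B]) (auto split: split_indicator)
    have "(\<integral>x. \<phi> x * g x \<partial>lborel) = (\<integral>x. \<phi> x \<partial>\<nu> A)"
      unfolding \<nu>A using g(3) by (subst integral_density) (auto simp: mult.commute)
    then have "(\<integral>x. \<phi> x \<partial>?\<nu>') + (\<integral>x. \<phi> x * g x \<partial>lborel) =
        (\<integral>\<omega>. indicator (space M - A) \<omega> * \<phi> (X \<omega>) + indicator A \<omega> * \<phi> (X \<omega>) \<partial>M)"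
      using i by (simp add: int)
    also have "\<dots> = (\<integral>\<omega>. \<phi> (X \<omega>) \<partial>M)"
      by (intro Bochner_Integration.integral_cong) (auto split: split_indicator)
    finally show ?thesis by simp
  qed
  \<comment> \<open>The discrete part does not charge \<open>- S\<close>, so it has derivative 0 at
    almost every point there; \<open>S\<close> itself has length 0.\<close>
  have "AE x in lborel. x \<notin> S"
    using S(1) by (intro AE_not_in countable_imp_null_set_lborel)
  moreover have "AE x in lborel. x \<in> - S \<longrightarrow> ((\<lambda>r. measure ?\<nu>' (cball x r) / r) \<longlongrightarrow> 0) (at_right 0)"
    by (rule AE_lborel_zero_density) (auto simp: fin sets_\<nu> S0)
  moreover note AE_lborel_Lebesgue_point[OF ig]
  ultimately have "AE x in lborel. 0 < ennreal (g x) \<longrightarrow>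
      (\<forall>z. ((\<lambda>\<sigma>. cond_noise M X f \<sigma> (x + \<sigma> * z)) \<longlongrightarrow> (\<integral>u. u * f u \<partial>lborel)) (at_right 0))"
  proof eventually_elim
    case (elim x)
    show ?case
    proof (intro impI allI)
      fix z assume "0 < ennreal (g x)"
      then have "g x \<noteq> 0" by auto
      show "((\<lambda>\<sigma>. cond_noise M X f \<sigma> (x + \<sigma> * z)) \<longlongrightarrow> (\<integral>u. u * f u \<partial>lborel)) (at_right 0)"
      proof (rule cond_noise_tendsto_density[OF _ sets_\<nu> _ ig _ _ _ f fm f1])
        show "(\<integral>\<omega>. \<phi> (X \<omega>) \<partial>M) = (\<integral>x. \<phi> x \<partial>?\<nu>') + (\<integral>x. \<phi> x * g x \<partial>lborel)"
          if "\<phi> \<in> borel_measurable borel" "\<And>x. \<bar>\<phi> x\<bar> \<le> B" for \<phi> B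
          using that by (rule law)
      qed (use elim \<open>g x \<noteq> 0\<close> fin in auto)
    qed
  qed
  \<comment> \<open>Under a measure with density \<open>g\<close> only points with g x > 0 matter,
    which makes the denominator harmless.\<close>
  then have "AE x in \<nu> A. \<forall>z. ((\<lambda>\<sigma>. cond_noise M X f \<sigma> (x + \<sigma> * z)) \<longlongrightarrow> (\<integral>u. u * f u \<partial>lborel)) (at_right 0)"
    unfolding \<nu>A by (subst AE_density) auto
  then have "AE \<omega> in density M (\<lambda>\<omega>. ennreal (indicator A \<omega>)).
      \<forall>z. ((\<lambda>\<sigma>. cond_noise M X f \<sigma> (X \<omega> + \<sigma> * z)) \<longlongrightarrow> (\<integral>u. u * f u \<partial>lborel)) (at_right 0)"
    unfolding \<nu>_def by (rule AE_distrD[rotated]) simp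
  then have onA: "AE \<omega> in M. 0 < ennreal (indicator A \<omega>) \<longrightarrow>
      (\<forall>z. ((\<lambda>\<sigma>. cond_noise M X f \<sigma> (X \<omega> + \<sigma> * z)) \<longlongrightarrow> (\<integral>u. u * f u \<partial>lborel)) (at_right 0))"
    by (subst (asm) AE_density) auto
  \<comment> \<open>These are countably many values, each taken with probability 0, and can be
    discarded together. The other points of \<open>S\<close> are atoms of the full law of
    \<open>X\<close>.\<close>
  define S0 where "S0 = {s \<in> S. measure M {\<omega> \<in> space M. X \<omega> = s} = 0}"
  have "AE \<omega> in M. \<forall>s\<in>S0. X \<omega> \<noteq> s"
  proof (rule AE_ball_countable')
    fix s assume "s \<in> S0"
    then have "{\<omega> \<in> space M. X \<omega> = s} \<in> null_sets M"
      by (auto simp: S0_def null_sets_def emeasure_eq_measure)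
    from AE_not_in[OF this] AE_space show "AE \<omega> in M. X \<omega> \<noteq> s" by eventually_elim auto
  qed (use S in \<open>auto simp: S0_def intro: countable_subset\<close>)
  with onA S(2) show ?thesis
  proof eventually_elim
    case (elim \<omega>)
    show ?case
    proof (cases "\<omega> \<in> A")
      case True
      then show ?thesis using elim by simp
    next
      case False
      then have "measure M {\<omega>' \<in> space M. X \<omega>' = X \<omega>} \<noteq> 0" using elim by (auto simp: S0_def)
      then show ?thesis using False cond_noise_tendsto_atom[OF prob_space_axioms X f fm] by simp
    qed
  qed
qed

text \<open>Integrability of \<open>Z\<close> belongs to the conclusion because the integral of a
  non-integrable function is 0 by convention; with it the limit contains the true mean. Equality of
  the two limits is expressed by giving both the same value.\<close>

theorem corollary1:
  fixes M :: "'a measure" and U :: "'a \<Rightarrow> nat"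
    and X\<^sub>1 X\<^sub>2 X Z :: "'a \<Rightarrow> real"
    and f :: "real \<Rightarrow> real" and \<alpha> :: real
  assumes "prob_space M"
    and "X\<^sub>1 \<in> borel_measurable M" and "X\<^sub>2 \<in> borel_measurable M"
    and "Z \<in> borel_measurable M"
    and "U \<in> measurable M (count_space {1, 2})"
    and "\<alpha> \<in> {0..1}"
    and "measure M {\<omega> \<in> space M. U \<omega> = 1} = \<alpha>"
    and "indep_rv M (count_space {1, 2}) U
           (borel \<Otimes>\<^sub>M borel) (\<lambda>\<omega>. (X\<^sub>1 \<omega>, X\<^sub>2 \<omega>))"
    and "\<And>\<omega>. X \<omega> = of_bool (U \<omega> = 1) * X\<^sub>1 \<omega> + of_bool (U \<omega> = 2) * X\<^sub>2 \<omega>"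
    and "indep_rv M borel Z
           (count_space {1, 2} \<Otimes>\<^sub>M borel \<Otimes>\<^sub>M borel) (\<lambda>\<omega>. (U \<omega>, X\<^sub>1 \<omega>, X\<^sub>2 \<omega>))"
    and "\<exists>S. countable S \<and> (AE \<omega> in M. X\<^sub>1 \<omega> \<in> S)"
    and "absolutely_continuous lborel (distr M borel X\<^sub>2)"
    and "doob_random_variable M Z f"
  shows "integrable M Z \<and>
    (AE \<omega> in M.
      ((\<lambda>\<sigma>. scaled_error M X Z f \<sigma> \<omega>)
         \<longlongrightarrow> of_bool (U \<omega> = 2) * ((\<integral>\<omega>'. Z \<omega>' \<partial>M) - Z \<omega>)) (at_right 0) \<and>
      ((\<lambda>\<sigma>. of_bool (U \<omega> = 2) * scaled_error M X\<^sub>2 Z f \<sigma> \<omega>)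
         \<longlongrightarrow> of_bool (U \<omega> = 2) * ((\<integral>\<omega>'. Z \<omega>' \<partial>M) - Z \<omega>)) (at_right 0))"
proof -
  let ?A = "{\<omega> \<in> space M. U \<omega> = 2}"
  note X = \<open>\<And>\<omega>. X \<omega> = of_bool (U \<omega> = 1) * X\<^sub>1 \<omega> + of_bool (U \<omega> = 2) * X\<^sub>2 \<omega>\<close>
  note [measurable] = \<open>X\<^sub>1 \<in> borel_measurable M\<close> \<open>X\<^sub>2 \<in> borel_measurable M\<close> \<open>Z \<in> borel_measurable M\<close>
  note U = \<open>U \<in> measurable M (count_space {1, 2})\<close>
  interpret prob_space M by fact
  have dist: "distributed M lborel Z (\<lambda>x. ennreal (f x))" and f: "doob_density f"
    using \<open>doob_random_variable M Z f\<close> by (auto simp: doob_random_variable_def)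
  have f0: "0 \<le> f u" for u using f by (simp add: doob_density_def)
  have fm[measurable]: "f \<in> borel_measurable borel"
    using distributed_real_measurable[OF _ dist] f0 by simp
  have f1: "(\<integral>u. f u \<partial>lborel) = 1"
    using distributed_integral[OF dist, of "\<lambda>_. 1"] f0 by (simp add: prob_space)
  have mean: "(\<integral>u. u * f u \<partial>lborel) = (\<integral>\<omega>. Z \<omega> \<partial>M)"
    using distributed_integral[OF dist, of "\<lambda>u. u"] f0 by (simp add: mult.commute)
  have "integrable lborel (\<lambda>u. f u * u)"
    by (rule Bochner_Integration.integrable_bound[OF doob_density_integrable[OF f fm]])
      (use f0 in \<open>auto simp: abs_mult\<close>)
  then have intZ: "integrable M Z" using distributed_integrable_var[OF dist f0] by simp
  have Ui: "{\<omega> \<in> space M. U \<omega> = i} \<in> sets M" if "i \<in> {1, 2}" for i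
  proof -
    have "{\<omega> \<in> space M. U \<omega> = i} = U -` {i} \<inter> space M" by auto
    then show ?thesis using measurable_sets[OF U, of "{i}"] that by simp
  qed
  have [measurable]: "Measurable.pred M (\<lambda>\<omega>. U \<omega> = 1)" "Measurable.pred M (\<lambda>\<omega>. U \<omega> = 2)"
    using Ui by (auto simp: pred_def)
  have Xm[measurable]: "X \<in> borel_measurable M"
    unfolding X[abs_def] by measurable
  have U12: "U \<omega> = 1 \<or> U \<omega> = 2" if "\<omega> \<in> space M" for \<omega>
    using measurable_space[OF U that] by auto
  obtain S where S: "countable S" "AE \<omega> in M. X\<^sub>1 \<omega> \<in> S"
    using \<open>\<exists>S. countable S \<and> (AE \<omega> in M. X\<^sub>1 \<omega> \<in> S)\<close> by blast
  have ac: "AE \<omega> in M. X\<^sub>2 \<omega> \<notin> N" if "N \<in> null_sets lborel" for N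
  proof -
    have "N \<in> null_sets (distr M borel X\<^sub>2)"
      using that \<open>absolutely_continuous lborel (distr M borel X\<^sub>2)\<close> by (auto simp: absolutely_continuous_def)
    then have "AE x in distr M borel X\<^sub>2. x \<notin> N" by (rule AE_not_in)
    then show ?thesis by (rule AE_distrD[rotated]) simp
  qed
  have "AE \<omega> in M. \<forall>z. ((\<lambda>\<sigma>. cond_noise M X f \<sigma> (X \<omega> + \<sigma> * z)) \<longlongrightarrow>
      (if \<omega> \<in> ?A then (\<integral>u. u * f u \<partial>lborel) else z)) (at_right 0)"
  proof (rule AE_cond_noise_tendsto[OF prob_space_axioms Xm _ S(1) _ _ f fm f1])
    show "AE \<omega> in M. \<omega> \<notin> ?A \<longrightarrow> X \<omega> \<in> S"
      using S(2) AE_space by eventually_elim (use U12 in \<open>auto simp: X\<close>)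
    show "AE \<omega> in M. \<omega> \<in> ?A \<longrightarrow> X \<omega> \<notin> N" if "N \<in> null_sets lborel" for N
      using ac[OF that] by eventually_elim (auto simp: X)
  qed measurable
  \<comment> \<open>The event is now the whole space, so the limit is the mean at almost every
    outcome.\<close>
  moreover have "AE \<omega> in M. \<forall>z. ((\<lambda>\<sigma>. cond_noise M X\<^sub>2 f \<sigma> (X\<^sub>2 \<omega> + \<sigma> * z)) \<longlongrightarrow>
      (if \<omega> \<in> space M then (\<integral>u. u * f u \<partial>lborel) else z)) (at_right 0)"
    by (rule AE_cond_noise_tendsto[OF prob_space_axioms _ _ S(1) _ _ f fm f1])
      (auto intro: eventually_mono[OF ac])
  \<comment> \<open>The two forms of the error agree for nonzero \<sigma>, hence eventually at 0
    from the right.\<close>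
  moreover have "\<forall>\<^sub>F \<sigma> in at_right 0. - Z \<omega> + cond_noise M W f \<sigma> (W \<omega> + \<sigma> * Z \<omega>) = scaled_error M W Z f \<sigma> \<omega>"
    for W \<omega>
    using eventually_at_right_less[of 0] by eventually_elim (simp add: scaled_error_eq)
  note error = Lim_transform_eventually[OF tendsto_add[OF tendsto_const] this]
  have "AE \<omega> in M.
      ((\<lambda>\<sigma>. scaled_error M X Z f \<sigma> \<omega>)
         \<longlongrightarrow> of_bool (U \<omega> = 2) * ((\<integral>\<omega>'. Z \<omega>' \<partial>M) - Z \<omega>)) (at_right 0) \<and>
      ((\<lambda>\<sigma>. of_bool (U \<omega> = 2) * scaled_error M X\<^sub>2 Z f \<sigma> \<omega>)
         \<longlongrightarrow> of_bool (U \<omega> = 2) * ((\<integral>\<omega>'. Z \<omega>' \<partial>M) - Z \<omega>)) (at_right 0)"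
    using calculation AE_space
  proof eventually_elim
    case (elim \<omega>)
    have "((\<lambda>\<sigma>. scaled_error M X Z f \<sigma> \<omega>) \<longlongrightarrow> - Z \<omega> + (if \<omega> \<in> ?A then (\<integral>u. u * f u \<partial>lborel) else Z \<omega>)) (at_right 0)"
      using elim(1) by (intro error) blast
    moreover have "((\<lambda>\<sigma>. scaled_error M X\<^sub>2 Z f \<sigma> \<omega>) \<longlongrightarrow> - Z \<omega> + (if \<omega> \<in> space M then (\<integral>u. u * f u \<partial>lborel) else Z \<omega>)) (at_right 0)"
      using elim(2) by (intro error) blast
    ultimately show ?case using elim(3) by (cases "U \<omega> = 2") (auto simp: mean)
  qed
  with intZ show ?thesis by blast
qed

end
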